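(* Let $\mathbf{X}^*\succeq0$ be an optimal solution of $\min\{f(\mathbf{X})+g(\mathbf{X}):\mathbf{X}\succeq0,\ \mathcal{A}(\mathbf{X})=\mathbf{b}\}$ and let $(\mathbf{y}^*,\boldsymbol\lambda^* )\in\mathbb{R}^m\times\mathcal{K}$ be a corresponding dual solution. Write $\nabla_{\mathbf{X}}\mathcal{L}^*:=\nabla_{\mathbf{X}}\mathcal{L}(\mathbf{X}^*,\mathbf{y}^*,\boldsymbol\lambda^* )=\nabla f(\mathbf{X}^* )-\mathcal{A}^\top(\mathbf{y}^* )+\nabla_{\mathbf{X}}G(\mathbf{X}^*,\boldsymbol\lambda^* )$ and $\tilde r:=n-\mathrm{rank}(\nabla_{\mathbf{X}}\mathcal{L}^* )$. Let $\{(\mathbf{X}_t,\mathbf{y}_t,\boldsymbol\lambda_t)\}_{t\ge1}$ and $\{(\mathbf{Z}_t,\mathbf{w}_t,\boldsymbol\mu_t)\}_{t\ge2}$ be the sequences generated by the extragradient method (defined in the context) with a fixed step-size $$\eta\le\min\left\{\begin{array}{l}\frac{1}{2\sqrt{(\beta+\rho_X)^2+\|\mathcal{A}\|^2+\rho_{\lambda X}^2}},\ \frac{1}{2\sqrt{\rho_\lambda^2+2\max\{\|\mathcal{A}\|^2,\rho_{X\lambda}^2\}}},\\ \frac{1}{\beta+\rho_X+\sqrt2\max\{\|\mathcal{A}\|,\rho_{X\lambda}\}},\ \frac{1}{\rho_\lambda+\sqrt{\|\mathcal{A}\|^2+\rho_{\lambda X}^2}}\end{array}\right\}.$$ Fix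 $r\ge\tilde r$ and assume the initialization satisfies $\|(\mathbf{X}_1,\mathbf{y}_1,\boldsymbol\lambda_1)-(\mathbf{X}^*,\mathbf{y}^*,\boldsymbol\lambda^* )\|\le R_0(r)$, where $$R_0(r):=\frac{\eta\max\{\lambda_{n-r}(\nabla_{\mathbf{X}}\mathcal{L}^* ),\ \sqrt{\tilde r}\,\lambda_{n-r+\tilde r-1}(\nabla_{\mathbf{X}}\mathcal{L}^* )\}}{2(1+2\eta\max\{\beta+\rho_X,\|\mathcal{A}\|,\rho_{X\lambda}\})}.$$ Then for all $t\ge1$ the projections $\Pi_{\mathbb{S}^n_+}[\cdot]$ in the extragradient method can be replaced with the rank-$r$ truncated projections $\widehat\Pi^r_{\mathbb{S}^n_+}[\cdot]$ without changing the sequences $\{(\mathbf{X}_t,\mathbf{y}_t,\boldsymbol\lambda_t)\}_{t\ge1}$ and $\{(\mathbf{Z}_t,\mathbf{w}_t,\boldsymbol\mu_t)\}_{t\ge2}$. Moreover, for all $T\ge1$, with $\bar{\mathbf{X}}=\frac1T\sum_{t=1}^T\mathbf{Z}_{t+1}$, $$f(\bar{\mathbf{X}})+g(\bar{\mathbf{X}})-f(\mathbf{X}^* )-g(\mathbf{X}^* )\le\frac{R^2}{2\eta T},\qquad\|\mathcal{A}(\bar{\mathbf{X}})-\mathbf{b}\|_2\le\frac{R^2}{2\|\mathbf{y}^*\|_2\,\eta T},$$ where $R^2=\|\mathbf{X}_1-\mathbf{X}^*\|_F^2+\max_{\mathbf{y}\in\mathbb{R}^m,\ \|\mathbf{y}\|_2\le2\|\mathbf{y}^*\|_2}\|\mathbf{y}_1-\mathbf{y}\|_2^2+\max_{\boldsymbol\lambda\in\mathcal{K}}\|\boldsymbol\lambda_1-\boldsymbol\lambda\|_2^2$.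 Furthermore, for all $T\ge1$, $$f(\mathbf{Z}_{T+1})+g(\mathbf{Z}_{T+1})-f(\mathbf{X}^* )-g(\mathbf{X}^* )\le\frac{R_1}{\eta\sqrt T},\qquad\|\mathcal{A}(\mathbf{Z}_{T+1})-\mathbf{b}\|_2\le\frac{R_1}{\|\mathbf{y}^*\|_2\,\eta\sqrt T},$$ where $R_1:=3\sqrt2\max\{2R_0(r),\,3\sqrt2\|\mathbf{y}^*\|_2,\,\sqrt2\,\mathrm{diam}(\mathcal{K})\}\cdot\|(\mathbf{X}_1,\mathbf{y}_1,\boldsymbol\lambda_1)-(\mathbf{X}^*,\mathbf{y}^*,\boldsymbol\lambda^* )\|$.
   Context: $\mathbb{S}^n$ is the space of $n\times n$ real symmetric matrices, $\mathbb{S}^n_+$ the positive semidefinite (PSD) ones, $\mathbb{S}^n_{++}$ the positive definite ones. Eigenvalues are ordered $\lambda_1(\cdot)\ge\dots\ge\lambda_n(\cdot)$. $f:\mathbb{S}^n\to\mathbb{R}$ is convex and $\beta$-smooth (its gradient is $\beta$-Lipschitz in Frobenius norm), $\mathbf{b}\in\mathbb{R}^m$, and $\mathcal{A}:\mathbb{S}^n\to\mathbb{R}^m$ is the linear map $\mathcal{A}(\mathbf{X})=(\langle\mathbf{X},\mathbf{A}_1\rangle,\dots,\langle\mathbf{X},\mathbf{A}_m\rangle)^\top$ with $\mathbf{A}_i\in\mathbb{S}^n$; $\mathcal{A}^\top(\mathbf{y})=\sum_i\mathbf{y}_i\mathbf{A}_i$ and $\|\mathcal{A}\|:=\max\{\|\mathcal{A}(\mathbf{X})\|_2:\|\mathbf{X}\|_F\le1\}$.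 Norms of tuples are Euclidean norms on the product space. $g:\mathbb{S}^n\to\mathbb{R}$ is convex, possibly nonsmooth, of the form $g(\mathbf{X})=\max_{\boldsymbol\lambda\in\mathcal{K}}G(\mathbf{X},\boldsymbol\lambda)$, where $\mathcal{K}$ is a compact convex subset of a finite-dimensional real Euclidean space (norm $\|\cdot\|_2$), $G(\cdot,\boldsymbol\lambda)$ is convex for all $\boldsymbol\lambda\in\mathcal{K}$, $G(\mathbf{X},\cdot)$ is concave for all $\mathbf{X}\succeq0$, $G$ is differentiable, and there are constants $\rho_X,\rho_\lambda,\rho_{X\lambda},\rho_{\lambda X}\ge0$ such that for all $\mathbf{X},\widetilde{\mathbf{X}}\succeq0$ and $\boldsymbol\lambda,\widetilde{\boldsymbol\lambda}\in\mathcal{K}$: $\|\nabla_{\mathbf{X}}G(\mathbf{X},\boldsymbol\lambda)-\nabla_{\mathbf{X}}G(\widetilde{\mathbf{X}},\boldsymbol\lambda)\|_F\le\rho_X\|\mathbf{X}-\widetilde{\mathbf{X}}\|_F$, $\|\nabla_{\boldsymbol\lambda}G(\mathbf{X},\boldsymbol\lambda)-\nabla_{\boldsymbol\lambda}G(\mathbf{X},\widetilde{\boldsymbol\lambda})\|_2\le\rho_\lambda\|\boldsymbol\lambda-\widetilde{\boldsymbol\lambda}\|_2$, $\|\nabla_{\mathbf{X}}G(\mathbf{X},\boldsymbol\lambda)-\nabla_{\mathbf{X}}G(\mathbf{X},\widetilde{\boldsymbol\lambda})\|_F\le\rho_{X\lambda}\|\boldsymbol\lambda-\widetilde{\boldsymbol\lambda}\|_2$,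 $\|\nabla_{\boldsymbol\lambda}G(\mathbf{X},\boldsymbol\lambda)-\nabla_{\boldsymbol\lambda}G(\widetilde{\mathbf{X}},\boldsymbol\lambda)\|_2\le\rho_{\lambda X}\|\mathbf{X}-\widetilde{\mathbf{X}}\|_F$. $\mathrm{diam}(\mathcal{K})$ is the Euclidean diameter and $\Pi_{\mathcal{K}}$ the Euclidean projection onto $\mathcal{K}$. Standing assumptions: there is $\mathbf{X}_{\mathrm{S}}\in\mathbb{S}^n_{++}$ with $\mathcal{A}(\mathbf{X}_{\mathrm{S}})=\mathbf{b}$ (Slater), and the minimization problem is bounded from below. Lagrangian: $\mathcal{L}(\mathbf{X},\mathbf{y},\boldsymbol\lambda):=f(\mathbf{X})+G(\mathbf{X},\boldsymbol\lambda)+\mathbf{y}^\top(\mathbf{b}-\mathcal{A}(\mathbf{X}))$. A dual solution $(\mathbf{y}^*,\boldsymbol\lambda^* )$ corresponding to $\mathbf{X}^*$ is one for which $(\mathbf{X}^*,(\mathbf{y}^*,\boldsymbol\lambda^* ))$ is a saddle-point of $\min_{\mathbf{X}\succeq0}\max_{\mathbf{y}\in\mathbb{R}^m,\boldsymbol\lambda\in\mathcal{K}}\mathcal{L}(\mathbf{X},\mathbf{y},\boldsymbol\lambda)$. For $\mathbf{X}\in\mathbb{S}^n$ with eigen-decomposition $\mathbf{X}=\sum_{i=1}^n\lambda_i\mathbf{v}_i\mathbf{v}_i^\top$, $\lambda_1\ge\dots\ge\lambda_n$, the Euclidean projection onto the PSD cone is $\Pi_{\mathbb{S}^n_+}[\mathbf{X}]=\sum_{i=1}^n\max\{\lambda_i,0\}\mathbf{v}_i\mathbf{v}_i^\top$,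 and the rank-$r$ truncated projection is $\widehat\Pi^r_{\mathbb{S}^n_+}[\mathbf{X}]:=\sum_{i=1}^r\max\{\lambda_i,0\}\mathbf{v}_i\mathbf{v}_i^\top$. Extragradient method with step-size $\eta>0$: start from $(\mathbf{X}_1,\mathbf{y}_1,\boldsymbol\lambda_1)\in\mathbb{S}^n_+\times\mathbb{R}^m\times\mathcal{K}$ and for $t=1,2,\dots$ set $\mathbf{Z}_{t+1}=\Pi_{\mathbb{S}^n_+}[\mathbf{X}_t-\eta\nabla_{\mathbf{X}}\mathcal{L}(\mathbf{X}_t,\mathbf{y}_t,\boldsymbol\lambda_t)]$, $\mathbf{w}_{t+1}=\mathbf{y}_t+\eta\nabla_{\mathbf{y}}\mathcal{L}(\mathbf{X}_t,\mathbf{y}_t,\boldsymbol\lambda_t)$, $\boldsymbol\mu_{t+1}=\Pi_{\mathcal{K}}[\boldsymbol\lambda_t+\eta\nabla_{\boldsymbol\lambda}\mathcal{L}(\mathbf{X}_t,\mathbf{y}_t,\boldsymbol\lambda_t)]$, $\mathbf{X}_{t+1}=\Pi_{\mathbb{S}^n_+}[\mathbf{X}_t-\eta\nabla_{\mathbf{X}}\mathcal{L}(\mathbf{Z}_{t+1},\mathbf{w}_{t+1},\boldsymbol\mu_{t+1})]$, $\mathbf{y}_{t+1}=\mathbf{y}_t+\eta\nabla_{\mathbf{y}}\mathcal{L}(\mathbf{Z}_{t+1},\mathbf{w}_{t+1},\boldsymbol\mu_{t+1})$, $\boldsymbol\lambda_{t+1}=\Pi_{\mathcal{K}}[\boldsymbol\lambda_t+\eta\nabla_{\boldsymbol\lambda}\mathcal{L}(\mathbf{Z}_{t+1},\mathbf{w}_{t+1},\boldsymbol\mu_{t+1})]$.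 The rank parameter $r$ and $\tilde r$ are such that the eigenvalue indices appearing are in $\{1,\dots,n\}$. A bound with $\|\mathbf{y}^*\|_2$ in the denominator is vacuous if $\mathbf{y}^*=0$. *)

theory Defs
  imports "HOL-Analysis.Analysis"
begin

text \<open>The norm and inner product of \<^typ>\<open>real^'n^'n\<close> are the Frobenius ones, and the norm of a
  product type is the Euclidean norm of the tuple.\<close>

definition sym_mats :: "(real^'n^'n) set" where
  "sym_mats = {M. transpose M = M}"

definition psd_cone :: "(real^'n^'n) set" where
  "psd_cone = {M \<in> sym_mats. \<forall>x. 0 \<le> x \<bullet> (M *v x)}"

definition pd_cone :: "(real^'n^'n) set" where
  "pd_cone = {M \<in> sym_mats. \<forall>x. x \<noteq> 0 \<longrightarrow> 0 < x \<bullet> (M *v x)}"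

definition outer :: "real^'n \<Rightarrow> real^'n \<Rightarrow> real^'n^'n" where
  "outer u v = (\<chi> i j. u $ i * v $ j)"

text \<open>The sequences \<open>l\<close> and \<open>v\<close> are only meaningful at the indices \<open>1, \<dots>, n\<close>.\<close>

definition eigen_decomposition :: "real^'n^'n \<Rightarrow> (nat \<Rightarrow> real) \<Rightarrow> (nat \<Rightarrow> real^'n) \<Rightarrow> bool" where
  "eigen_decomposition M l v \<longleftrightarrow>
     (\<forall>i\<in>{1..CARD('n)}. \<forall>j\<in>{1..CARD('n)}. v i \<bullet> v j = (if i = j then 1 else 0)) \<and>
     (\<forall>i\<in>{1..CARD('n)}. \<forall>j\<in>{1..CARD('n)}. i \<le> j \<longrightarrow> l j \<le> l i) \<and>
     M = (\<Sum>i=1..CARD('n). l i *\<^sub>R outer (v i) (v i))"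

text \<open>The \<open>i\<close>-th largest eigenvalue, with multiplicity. For symmetric \<open>M\<close> and \<open>1 \<le> i \<le> n\<close> the value
  \<open>l i\<close> is the same in all eigen-decompositions of \<open>M\<close>; other arguments are junk.\<close>

definition eigval :: "nat \<Rightarrow> real^'n^'n \<Rightarrow> real" where
  "eigval i M = (THE a. \<exists>l v. eigen_decomposition M l v \<and> a = l i)"

text \<open>Projections onto the positive semidefinite cone are treated as relations between a matrix
  and its projection, because the truncated projection depends on the chosen eigen-decomposition
  when the \<open>r\<close>-th and \<open>(r+1)\<close>-st eigenvalues coincide and are positive.\<close>

definition psd_proj :: "real^'n^'n \<Rightarrow> real^'n^'n \<Rightarrow> bool" where
  "psd_proj M Y \<longleftrightarrow> Y = closest_point psd_cone M"

definition trunc_psd_proj :: "nat \<Rightarrow> real^'n^'n \<Rightarrow> real^'n^'n \<Rightarrow> bool" where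
  "trunc_psd_proj r M Y \<longleftrightarrow>
     (\<exists>l v. eigen_decomposition M l v \<and> Y = (\<Sum>i=1..r. max (l i) 0 *\<^sub>R outer (v i) (v i)))"

definition lin_map :: "('m \<Rightarrow> real^'n^'n) \<Rightarrow> real^'n^'n \<Rightarrow> real^'m" where
  "lin_map A X = (\<chi> i. X \<bullet> A i)"

definition adj_map :: "('m::finite \<Rightarrow> real^'n^'n) \<Rightarrow> real^'m \<Rightarrow> real^'n^'n" where
  "adj_map A y = (\<Sum>i\<in>UNIV. (y $ i) *\<^sub>R A i)"

definition map_norm :: "('m::finite \<Rightarrow> real^'n^'n) \<Rightarrow> real" where
  "map_norm A = (SUP X\<in>{X \<in> sym_mats. norm X \<le> 1}. norm (lin_map A X))"

definition feasible :: "('m::finite \<Rightarrow> real^'n^'n) \<Rightarrow> real^'m \<Rightarrow> (real^'n^'n) set" where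
  "feasible A b = {X \<in> psd_cone. lin_map A X = b}"

definition lagrangian ::
    "(real^'n^'n \<Rightarrow> real) \<Rightarrow> (real^'n^'n \<Rightarrow> 'e \<Rightarrow> real) \<Rightarrow> ('m::finite \<Rightarrow> real^'n^'n) \<Rightarrow> real^'m \<Rightarrow>
     real^'n^'n \<Rightarrow> real^'m \<Rightarrow> 'e \<Rightarrow> real" where
  "lagrangian f G A b X y l = f X + G X l + y \<bullet> (b - lin_map A X)"

definition saddle_point ::
    "(real^'n^'n \<Rightarrow> real^'m \<Rightarrow> 'e \<Rightarrow> real) \<Rightarrow> 'e set \<Rightarrow> real^'n^'n \<Rightarrow> real^'m \<Rightarrow> 'e \<Rightarrow> bool" where
  "saddle_point L K Xs ys ls \<longleftrightarrow>
     Xs \<in> psd_cone \<and> ls \<in> K \<and>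
     (\<forall>y. \<forall>l\<in>K. L Xs y l \<le> L Xs ys ls) \<and> (\<forall>X\<in>psd_cone. L Xs ys ls \<le> L X ys ls)"

text \<open>Gradients of functions on the space of symmetric matrices are symmetric matrices, and
  differentiability is relative to that space.\<close>

definition is_gradient_sym :: "(real^'n^'n \<Rightarrow> real) \<Rightarrow> (real^'n^'n \<Rightarrow> real^'n^'n) \<Rightarrow> bool" where
  "is_gradient_sym f gradf \<longleftrightarrow>
     (\<forall>X\<in>sym_mats. gradf X \<in> sym_mats \<and>
        (f has_derivative (\<lambda>H. gradf X \<bullet> H)) (at X within sym_mats))"

text \<open>Joint differentiability of \<open>G\<close> on the product of the space of symmetric matrices and \<open>K\<close>.
  When \<open>K\<close> has empty interior, the partial gradient in the second argument is not unique, and any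
  choice of it is allowed.\<close>

definition are_partial_gradients ::
    "'e::euclidean_space set \<Rightarrow> (real^'n^'n \<Rightarrow> 'e \<Rightarrow> real) \<Rightarrow>
     (real^'n^'n \<Rightarrow> 'e \<Rightarrow> real^'n^'n) \<Rightarrow> (real^'n^'n \<Rightarrow> 'e \<Rightarrow> 'e) \<Rightarrow> bool" where
  "are_partial_gradients K G GX Gl \<longleftrightarrow>
     (\<forall>X\<in>sym_mats. \<forall>l\<in>K. GX X l \<in> sym_mats \<and>
        ((\<lambda>(X, l). G X l) has_derivative (\<lambda>(H, h). GX X l \<bullet> H + Gl X l \<bullet> h))
          (at (X, l) within sym_mats \<times> K))"

text \<open>The three partial gradients of the Lagrangian; see \<open>lagrangian_has_derivative\<close> below.\<close>

definition grad_X where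
  "grad_X gradf GX A X y l = gradf X - adj_map A y + GX X l"

definition grad_y where
  "grad_y A b X y l = b - lin_map A X"

definition grad_l where
  "grad_l Gl X y l = Gl X l"

lemma bounded_linear_lin_map: "bounded_linear (lin_map A :: real^'n^'n \<Rightarrow> real^'m::finite)"
  unfolding lin_map_def linear_conv_bounded_linear[symmetric]
  by (rule linearI) (simp_all add: vec_eq_iff inner_add_left)

lemma inner_lin_map: "y \<bullet> lin_map A H = adj_map A y \<bullet> H"
  by (simp add: adj_map_def lin_map_def inner_sum_left inner_sum_right inner_vec_def[of y]
      inner_commute)

lemma lagrangian_has_derivative:
  fixes X :: "real^'n^'n" and y :: "real^'m::finite" and l :: "'e::euclidean_space"
  assumes f: "is_gradient_sym f gradf" and G: "are_partial_gradients K G GX Gl"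
    and X: "X \<in> sym_mats" and l: "l \<in> K"
  shows "((\<lambda>(X, y, l). lagrangian f G A b X y l) has_derivative
     (\<lambda>(H, k, h). grad_X gradf GX A X y l \<bullet> H + grad_y A b X y l \<bullet> k + grad_l Gl X y l \<bullet> h))
     (at (X, y, l) within sym_mats \<times> UNIV \<times> K)"
proof -
  let ?S = "sym_mats \<times> UNIV \<times> K :: ((real^'n^'n) \<times> (real^'m) \<times> 'e) set"
  let ?h = "\<lambda>p::(real^'n^'n) \<times> (real^'m) \<times> 'e. (fst p, snd (snd p))"
  have "(f has_derivative (\<bullet>) (gradf X)) (at X within sym_mats)"
    using f X by (simp add: is_gradient_sym_def)
  then have "(f has_derivative (\<bullet>) (gradf X)) (at (fst (X, y, l)) within fst ` ?S)"
    by (auto intro: has_derivative_subset)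
  from has_derivative_in_compose[OF
      bounded_linear.has_derivative[OF bounded_linear_fst has_derivative_ident] this]
  have df: "((\<lambda>p. f (fst p)) has_derivative (\<lambda>p. gradf X \<bullet> fst p)) (at (X, y, l) within ?S)"
    by simp
  have h: "(?h has_derivative ?h) (at (X, y, l) within ?S)"
    by (intro derivative_intros)
  have "((\<lambda>(X, l). G X l) has_derivative (\<lambda>(H, h). GX X l \<bullet> H + Gl X l \<bullet> h))
          (at (X, l) within sym_mats \<times> K)"
    using G X l unfolding are_partial_gradients_def by blast
  moreover have "?h ` ?S \<subseteq> sym_mats \<times> K"
    by auto
  ultimately have "((\<lambda>(X, l). G X l) has_derivative (\<lambda>(H, h). GX X l \<bullet> H + Gl X l \<bullet> h))
          (at (?h (X, y, l)) within ?h ` ?S)"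
    unfolding fst_conv snd_conv by (rule has_derivative_subset)
  from has_derivative_in_compose[OF h this]
  have dG: "((\<lambda>p. G (fst p) (snd (snd p))) has_derivative
      (\<lambda>p. GX X l \<bullet> fst p + Gl X l \<bullet> snd (snd p))) (at (X, y, l) within ?S)"
    by simp
  have dA: "((\<lambda>p. fst (snd p) \<bullet> (b - lin_map A (fst p))) has_derivative
      (\<lambda>p. grad_y A b X y l \<bullet> fst (snd p) - adj_map A y \<bullet> fst p)) (at (X, y, l) within ?S)"
    by (rule derivative_eq_intros bounded_linear.has_derivative[OF bounded_linear_lin_map] refl)+
      (simp add: inner_lin_map grad_y_def inner_commute algebra_simps)
  show ?thesis
    using has_derivative_add[OF has_derivative_add[OF df dG] dA]
    by (simp add: lagrangian_def case_prod_unfold grad_X_def grad_l_def inner_diff_left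
        inner_add_left algebra_simps)
qed

text \<open>One run of the extragradient method, with \<open>P\<close> in place of the projection onto the positive
  semidefinite cone. The sequences \<open>X\<close>, \<open>y\<close>, \<open>l\<close> start at index 1, the others at index 2.\<close>

definition extragradient ::
    "(real^'n^'n \<Rightarrow> real^'n^'n \<Rightarrow> bool) \<Rightarrow>
     (real^'n^'n \<Rightarrow> real^'m::finite \<Rightarrow> 'e \<Rightarrow> real^'n^'n) \<Rightarrow>
     (real^'n^'n \<Rightarrow> real^'m \<Rightarrow> 'e \<Rightarrow> real^'m) \<Rightarrow>
     (real^'n^'n \<Rightarrow> real^'m \<Rightarrow> 'e \<Rightarrow> 'e) \<Rightarrow>
     'e::euclidean_space set \<Rightarrow> real \<Rightarrow>
     (nat \<Rightarrow> real^'n^'n) \<Rightarrow> (nat \<Rightarrow> real^'m) \<Rightarrow> (nat \<Rightarrow> 'e) \<Rightarrow>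
     (nat \<Rightarrow> real^'n^'n) \<Rightarrow> (nat \<Rightarrow> real^'m) \<Rightarrow> (nat \<Rightarrow> 'e) \<Rightarrow> bool" where
  "extragradient P LX Ly Ll K \<eta> X y l Z w \<mu> \<longleftrightarrow>
     (\<forall>t\<ge>1.
        P (X t - \<eta> *\<^sub>R LX (X t) (y t) (l t)) (Z (t + 1)) \<and>
        w (t + 1) = y t + \<eta> *\<^sub>R Ly (X t) (y t) (l t) \<and>
        \<mu> (t + 1) = closest_point K (l t + \<eta> *\<^sub>R Ll (X t) (y t) (l t)) \<and>
        P (X t - \<eta> *\<^sub>R LX (Z (t + 1)) (w (t + 1)) (\<mu> (t + 1))) (X (t + 1)) \<and>
        y (t + 1) = y t + \<eta> *\<^sub>R Ly (Z (t + 1)) (w (t + 1)) (\<mu> (t + 1)) \<and>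
        l (t + 1) = closest_point K (l t + \<eta> *\<^sub>R Ll (Z (t + 1)) (w (t + 1)) (\<mu> (t + 1))))"

text \<open>The bound on the step-size is taken in \<^typ>\<open>ereal\<close>, where \<open>1 / 0 = \<infinity>\<close>: a term with a vanishing
  denominator imposes no constraint, whereas \<open>1 / 0 = 0\<close> in \<^typ>\<open>real\<close>.\<close>

definition step_bound :: "real \<Rightarrow> real \<Rightarrow> real \<Rightarrow> real \<Rightarrow> real \<Rightarrow> real \<Rightarrow> ereal" where
  "step_bound \<beta> \<rho>X \<rho>l \<rho>Xl \<rho>lX nA = Min {
     1 / ereal (2 * sqrt ((\<beta> + \<rho>X)\<^sup>2 + nA\<^sup>2 + \<rho>lX\<^sup>2)),
     1 / ereal (2 * sqrt (\<rho>l\<^sup>2 + 2 * max (nA\<^sup>2) (\<rho>Xl\<^sup>2))),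
     1 / ereal (\<beta> + \<rho>X + sqrt 2 * max nA \<rho>Xl),
     1 / ereal (\<rho>l + sqrt (nA\<^sup>2 + \<rho>lX\<^sup>2))}"

end

theory Submission
  imports Defs
begin

text \<open>Scaled by \<open>\<eta>\<close>, the saddle operator \<open>F\<close> is monotone and, by the first two step-size conditions,
  Lipschitz with constant \<open>1 / sqrt 2\<close>. The distance to the saddle point therefore never increases, and
  the summed one-step inequalities give the ergodic rate.

  Truncation: \<open>X\<^sup>* - \<eta> \<nabla>L\<^sup>*\<close> is negative on the range of \<open>\<nabla>L\<^sup>*\<close>. If a matrix had \<open>r + 1\<close> positive
  eigenvalues, the span of the eigenvectors would meet the span of the top eigenvectors of \<open>\<nabla>L\<^sup>*\<close> in a
  space of dimension \<open>p\<close> (with \<open>p = 1\<close> or \<open>p = rt\<close>), and testing the difference against the projection onto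
  that space shows that the Frobenius distance is too large. Within the radius \<open>R\<^sub>0\<close> all matrices to be
  projected are close enough.

  Last iterate: the tangent residual \<open>\<parallel>F z + c\<parallel>\<close>, with \<open>c\<close> the normal vector produced by the projection
  step, never increases, and its square is at most 6 times the decrease of the squared distance; hence
  \<open>\<parallel>z\<^sub>T - z\<^sub>T\<^sub>+\<^sub>1\<parallel>\<^sup>2 \<le> 9 \<parallel>z\<^sub>1 - z\<^sup>*\<parallel>\<^sup>2 / T\<close>. The gap at the half step is bounded by
  \<open>(\<parallel>z\<^sub>T - v\<parallel>\<^sup>2 - \<parallel>z\<^sub>T\<^sub>+\<^sub>1 - v\<parallel>\<^sup>2) / 2\<close>, the inner product of this displacement with the difference of
  the midpoint and \<open>v\<close>.\<close>

section \<open>Extragradient steps for monotone Lipschitz operators\<close>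

text \<open>The step-size is absorbed into \<open>F\<close>, so every step below has unit
  length.\<close>

locale monotone_lipschitz =
  fixes C :: "'z::real_inner set" and F :: "'z \<Rightarrow> 'z"
  assumes mono: "\<And>x y. x \<in> C \<Longrightarrow> y \<in> C \<Longrightarrow> 0 \<le> (F x - F y) \<bullet> (x - y)"
    and lipschitz: "\<And>x y. x \<in> C \<Longrightarrow> y \<in> C \<Longrightarrow> 2 * (norm (F x - F y))\<^sup>2 \<le> (norm (x - y))\<^sup>2"
begin

text \<open>The projections onto \<open>C\<close> are encoded by their variational inequalities, the
  form in which every later estimate uses them; a projection onto a product set can then be treated
  componentwise.\<close>

definition eg_step :: "'z \<Rightarrow> 'z \<Rightarrow> 'z \<Rightarrow> bool" where
  "eg_step z w z' \<longleftrightarrow> z \<in> C \<and> w \<in> C \<and> z' \<in> C \<and>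
     (\<forall>v\<in>C. (z - F z - w) \<bullet> (v - w) \<le> 0 \<and> (z - F w - z') \<bullet> (v - z') \<le> 0)"

text \<open>The amount by which a step is guaranteed to lower the squared distance to a solution; it
  is what is left over in \<open>eg_step_gap\<close>.\<close>

definition decrease :: "'z \<Rightarrow> 'z \<Rightarrow> 'z \<Rightarrow> real" where
  "decrease z w z' = (norm (z - w))\<^sup>2 + (norm (w - z'))\<^sup>2 - 2 * ((F w - F z) \<bullet> (w - z'))"

text \<open>Twice the sum of two projection inequalities: the corrector's tested at \<open>v\<close>
  and the predictor's tested at \<open>z'\<close>.\<close>

lemma eg_step_gap:
  assumes "eg_step z w z'" "v \<in> C"
  shows "2 * (F w \<bullet> (w - v)) \<le> (norm (z - v))\<^sup>2 - (norm (z' - v))\<^sup>2 - decrease z w z'"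
proof -
  have "(z - F w - z') \<bullet> (v - z') \<le> 0" "(z - F z - w) \<bullet> (z' - w) \<le> 0"
    using assms by (auto simp: eg_step_def)
  then show ?thesis
    by (simp add: decrease_def power2_norm_eq_inner inner_simps inner_commute)
qed

text \<open>Completing the square in \<open>w - z'\<close> leaves
  \<open>- (norm (F w - F z))\<^sup>2\<close>, which costs at most half of
  \<open>(norm (z - w))\<^sup>2\<close>.\<close>

lemma decrease_ge:
  assumes "eg_step z w z'"
  shows "(norm (z - w))\<^sup>2 \<le> 2 * decrease z w z'"
proof -
  have "2 * (norm (F w - F z))\<^sup>2 \<le> (norm (w - z))\<^sup>2"
    using assms lipschitz by (auto simp: eg_step_def)
  moreover have "0 \<le> (norm ((F w - F z) - (w - z')))\<^sup>2"
    by simp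
  ultimately show ?thesis
    by (simp add: decrease_def power2_norm_eq_inner inner_simps inner_commute)
qed

text \<open>In these differences the step estimates become linear inequalities between inner
  products of four vectors. The third fact is the sum of the two projection inequalities; the others
  are monotonicity and the Lipschitz bound.\<close>

lemma eg_step_facts:
  assumes "eg_step z w z'"
  defines "u \<equiv> z - w" and "e \<equiv> w - z'" and "p \<equiv> F w - F z" and "q \<equiv> F z' - F w"
  shows "u \<bullet> p \<le> 0" "2 * (p \<bullet> p) \<le> u \<bullet> u" "e \<bullet> e \<le> e \<bullet> p" "e \<bullet> q \<le> 0" "2 * (q \<bullet> q) \<le> e \<bullet> e"
proof -
  have C: "z \<in> C" "w \<in> C" "z' \<in> C"
    and N: "(z - F z - w) \<bullet> (z' - w) \<le> 0" "(z - F w - z') \<bullet> (w - z') \<le> 0"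
    using assms by (auto simp: eg_step_def)
  show "u \<bullet> p \<le> 0" "e \<bullet> q \<le> 0"
    using mono[of w z] mono[of w z'] C
    by (simp_all add: u_def p_def e_def q_def inner_simps inner_commute)
  show "2 * (p \<bullet> p) \<le> u \<bullet> u" "2 * (q \<bullet> q) \<le> e \<bullet> e"
    using lipschitz[of w z] lipschitz[of z' w] C
    by (simp_all add: u_def p_def e_def q_def flip: power2_norm_eq_inner)
      (metis norm_minus_commute)+
  show "e \<bullet> e \<le> e \<bullet> p"
    using N by (simp add: p_def e_def inner_simps inner_commute)
qed

text \<open>The vector on the left is the residual at \<open>z'\<close>: \<open>F z'\<close> plus
  the normal vector \<open>z - F w - z'\<close> produced by the corrector.\<close>

lemma residual_le_decrease:
  assumes "eg_step z w z'"
  shows "(norm (z - z' + F z' - F w))\<^sup>2 \<le> 6 * decrease z w z'"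
proof -
  define u e p q where defs: "u = z - w" "e = w - z'" "p = F w - F z" "q = F z' - F w"
  note facts = eg_step_facts[OF assms, folded defs]
  \<comment> \<open>The multipliers \<open>2\<close>, \<open>19/2\<close> and \<open>9\<close> make \<open>6 * decrease - residual\<^sup>2\<close> a nonnegative combination of
    these squares and the inequalities in \<open>facts\<close>.\<close>
  have "0 \<le> (norm (u - 2 *\<^sub>R q))\<^sup>2" "0 \<le> (norm ((19/2) *\<^sub>R e - u - 9 *\<^sub>R p))\<^sup>2"
    by simp_all
  then have sq: "0 \<le> u \<bullet> u - 4 * (u \<bullet> q) + 4 * (q \<bullet> q)"
      "0 \<le> 361/4 * (e \<bullet> e) - 19 * (u \<bullet> e) - 171 * (e \<bullet> p) + u \<bullet> u + 18 * (u \<bullet> p) + 81 * (p \<bullet> p)"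
    by (simp_all add: power2_norm_eq_inner inner_simps inner_commute algebra_simps)
  have "(norm (u + e + q))\<^sup>2 =
      u \<bullet> u + e \<bullet> e + q \<bullet> q + 2 * (u \<bullet> e) + 2 * (u \<bullet> q) + 2 * (e \<bullet> q)"
    by (simp add: power2_norm_eq_inner inner_simps inner_commute)
  moreover have "2 * (u \<bullet> q) \<le> 1/2 * (u \<bullet> u) + e \<bullet> e"
    using sq(1) facts(5) by linarith
  moreover have "- 2 * (u \<bullet> e) - 18 * (e \<bullet> p) \<ge> - 19/2 * (e \<bullet> e) - 83/19 * (u \<bullet> u)"
    using sq(2) facts(1,2) by linarith
  ultimately have "(norm (u + e + q))\<^sup>2 \<le> 6 * (u \<bullet> u + e \<bullet> e - 2 * (e \<bullet> p))"
    using facts(3-5) inner_ge_zero[of u] by argo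
  moreover have "z - z' + F z' - F w = u + e + q"
    by (simp add: defs)
  ultimately show ?thesis
    unfolding decrease_def by (simp only: power2_norm_eq_inner inner_commute flip: defs)
qed

text \<open>The corrector moves less than the predictor:
  \<open>e \<bullet> e \<le> p \<bullet> p \<le> (u \<bullet> u) / 2\<close>, so the whole
  displacement squared is at most \<open>3 * (u \<bullet> u)\<close>.\<close>

lemma displacement_le_decrease:
  assumes "eg_step z w z'"
  shows "(norm (z - z'))\<^sup>2 \<le> 6 * decrease z w z'"
proof -
  define u e p where defs: "u = z - w" "e = w - z'" "p = F w - F z"
  note facts = eg_step_facts[OF assms, folded defs]
  have "0 \<le> (norm (e - p))\<^sup>2" "0 \<le> (norm (u - e))\<^sup>2"
    by simp_all
  then have "(norm (u + e))\<^sup>2 \<le> 3 * (norm u)\<^sup>2"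
    using facts by (simp add: power2_norm_eq_inner inner_simps inner_commute)
  then show ?thesis
    using decrease_ge[OF assms] by (simp add: defs)
qed

text \<open>The residual of a point is \<open>F z + c\<close> with \<open>c\<close> in the normal cone at \<open>z\<close>; the new point has the
  normal vector \<open>z - F w - z'\<close>.\<close>

lemma residual_step:
  assumes "eg_step z w z'" and c: "\<And>v. v \<in> C \<Longrightarrow> c \<bullet> (v - z) \<le> 0"
  shows "(norm (z - z' + F z' - F w))\<^sup>2 \<le> (norm (F z + c))\<^sup>2" (is ?mono)
    and "2 * (norm (z - z'))\<^sup>2 \<le> 3 * (norm (F z + c))\<^sup>2" (is ?displ)
proof -
  have C: "z \<in> C" "w \<in> C" "z' \<in> C"
    and N: "(z - F z - w) \<bullet> (z' - w) \<le> 0" "(z - F z - w) \<bullet> (z - w) \<le> 0"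
      "(z - F w - z') \<bullet> (w - z') \<le> 0" "(z - F w - z') \<bullet> (z - z') \<le> 0"
    using assms by (auto simp: eg_step_def)
  have cw: "c \<bullet> (w - z) \<le> 0" and "c \<bullet> (z' - z) \<le> 0"
    using C c by auto
  \<comment> \<open>This square is how the old residual enters: it bounds
    \<open>(norm (F z + c))\<^sup>2\<close> below by
    \<open>2 * ((F z + c) \<bullet> (z - w)) - (norm (z - w))\<^sup>2\<close>.\<close>
  have n: "0 \<le> (norm (z - F z - w - c))\<^sup>2" by simp
  note m = mono[OF C(2) C(1)] mono[OF C(3) C(1)]
  show ?mono
    using cw C N n m lipschitz[OF C(3) C(2)] inner_ge_zero[of "w - z'"]
    by (simp add: power2_norm_eq_inner inner_simps inner_commute)
  have "0 \<le> (norm (F w - F z - (w - z')))\<^sup>2" by simp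
  then have "(norm (z - z'))\<^sup>2 \<le> (norm (F z + c))\<^sup>2 + (norm (F w - F z))\<^sup>2"
    using cw C N n m
    by (simp add: power2_norm_eq_inner inner_simps inner_commute)
  moreover have "(norm (z - w))\<^sup>2 \<le> (norm (F z + c))\<^sup>2"
  proof -
    have "(norm (z - w))\<^sup>2 \<le> (F z + c) \<bullet> (z - w)"
      using N cw by (simp add: power2_norm_eq_inner inner_simps inner_commute)
    moreover have "0 \<le> (norm (F z + c - (z - w)))\<^sup>2" by simp
    ultimately show ?thesis
      by (simp add: power2_norm_eq_inner inner_simps inner_commute)
  qed
  \<comment> \<open>The factor 3/2 arises because \<open>(norm (F w - F z))\<^sup>2\<close> is at
    most half of \<open>(norm (z - w))\<^sup>2\<close>, which is itself at most the squared
    residual.\<close>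
  ultimately show ?displ
    using lipschitz[OF C(2) C(1)] unfolding norm_minus_commute[of w z] by linarith
qed

text \<open>The solution enters in Minty form, with \<open>F\<close> evaluated at the test point,
  here \<open>w\<close>. For the corrector this makes \<open>decrease\<close> a true drop. For the
  predictor, testing its projection at \<open>x\<close> leaves the error \<open>F w - F z\<close>,
  whose norm is at most \<open>norm (z - x)\<close>; hence the factor 2.\<close>

lemma dist_half_step_le:
  assumes "eg_step z w z'" "x \<in> C" and sol: "\<And>v. v \<in> C \<Longrightarrow> 0 \<le> F v \<bullet> (v - x)"
  shows "norm (w - x) \<le> 2 * norm (z - x)" "norm (z' - x) \<le> norm (z - x)"
proof -
  have C: "z \<in> C" "w \<in> C" and N: "(z - F z - w) \<bullet> (x - w) \<le> 0"
    using assms by (auto simp: eg_step_def)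
  have d: "(norm (z' - x))\<^sup>2 + decrease z w z' \<le> (norm (z - x))\<^sup>2"
    using eg_step_gap[OF assms(1,2)] sol[OF C(2)] by linarith
  have "0 \<le> decrease z w z'"
    using decrease_ge[OF assms(1)] zero_le_power2[of "norm (z - w)"] by linarith
  then show "norm (z' - x) \<le> norm (z - x)"
    using d by (intro power2_le_imp_le[of "norm (z' - x)" "norm (z - x)"]) (linarith, simp)
  have "(norm (F w - F z))\<^sup>2 \<le> (norm (z - x))\<^sup>2"
    using d decrease_ge[OF assms(1)] lipschitz[OF C(2,1)] zero_le_power2[of "norm (z' - x)"]
    unfolding norm_minus_commute[of w z] by linarith
  then have F: "norm (F w - F z) \<le> norm (z - x)"
    using power2_le_imp_le by force
  have "(norm (w - x))\<^sup>2 \<le> (z - x + (F w - F z)) \<bullet> (w - x)"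
    using N sol[OF C(2)] by (simp add: power2_norm_eq_inner inner_simps inner_commute)
  also have "\<dots> \<le> norm (z - x + (F w - F z)) * norm (w - x)"
    by (rule norm_cauchy_schwarz)
  also have "\<dots> \<le> 2 * norm (z - x) * norm (w - x)"
    using norm_triangle_ineq[of "z - x" "F w - F z"] F by (intro mult_right_mono) auto
  finally show "norm (w - x) \<le> 2 * norm (z - x)"
    by (cases "w = x") (auto simp: power2_eq_square)
qed

text \<open>A residual that never increases and whose squares are summable with total
  \<open>6 * (norm (z 1 - x))\<^sup>2\<close> has squares of order \<open>1 / t\<close>; the
  displacement is controlled by the preceding residual.\<close>

lemma displacement_rate:
  assumes step: "\<And>t. t \<ge> 1 \<Longrightarrow> eg_step (z t) (w (Suc t)) (z (Suc t))"
    and x: "x \<in> C" and sol: "\<And>v. v \<in> C \<Longrightarrow> 0 \<le> F v \<bullet> (v - x)" and T: "T \<ge> 1"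
  shows "real T * (norm (z T - z (Suc T)))\<^sup>2 \<le> 9 * (norm (z 1 - x))\<^sup>2"
proof -
  define a where "a t = (norm (z t - z (Suc t) + F (z (Suc t)) - F (w (Suc t))))\<^sup>2" for t
  have normal: "(z t - F (w (Suc t)) - z (Suc t)) \<bullet> (v - z (Suc t)) \<le> 0"
    if "t \<ge> 1" "v \<in> C" for t v
    using step[OF that(1)] that(2) by (auto simp: eg_step_def)
  have a_eq: "a t = (norm (F (z (Suc t)) + (z t - F (w (Suc t)) - z (Suc t))))\<^sup>2" for t
    by (simp add: a_def algebra_simps)
  have a_step: "a (Suc t) \<le> a t"
    and displ: "2 * (norm (z (Suc t) - z (Suc (Suc t))))\<^sup>2 \<le> 3 * a t" if "t \<ge> 1" for t
    using residual_step[OF step[of "Suc t"] normal[OF that]] by (simp_all add: a_eq[of t] a_def[of "Suc t"])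
  have descent: "(norm (z (Suc t) - x))\<^sup>2 + decrease (z t) (w (Suc t)) (z (Suc t)) \<le> (norm (z t - x))\<^sup>2"
    if "t \<ge> 1" for t
    using eg_step_gap[OF step[OF that] x] sol[of "w (Suc t)"] step[OF that]
    by (auto simp: eg_step_def)
  \<comment> \<open>The quantity \<open>real t * a t + 6 * (norm (z (Suc t) - x))\<^sup>2\<close>
    never increases: passing to \<open>Suc t\<close> adds one residual, paid for by the drop of the
    distance.\<close>
  have potential: "real t * a t + 6 * (norm (z (Suc t) - x))\<^sup>2 \<le> 6 * (norm (z 1 - x))\<^sup>2"
    if "t \<ge> 1" for t
    using that
  proof (induction t rule: nat_induct_at_least)
    case base
    then show ?case
      using residual_le_decrease[OF step[of 1]] descent[of 1] by (simp add: a_def)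
  next
    case (Suc t)
    have "real t * a (Suc t) \<le> real t * a t"
      using a_step[OF Suc(1)] by (simp add: mult_left_mono)
    moreover have "a (Suc t) + 6 * (norm (z (Suc (Suc t)) - x))\<^sup>2 \<le> 6 * (norm (z (Suc t) - x))\<^sup>2"
      using residual_le_decrease[OF step[of "Suc t"]] descent[of "Suc t"] by (simp add: a_def)
    ultimately show ?case
      using Suc.IH by (simp add: algebra_simps)
  qed
  \<comment> \<open>The residual bound lags by one index and so covers only \<open>T - 1\<close>
    copies of the displacement. The missing copy is charged to the distance term at \<open>T\<close>
    kept in \<open>potential\<close>, which carries the factor 9 after scaling by 3/2.\<close>
  have last: "(norm (z T - z (Suc T)))\<^sup>2 \<le> 6 * (norm (z T - x))\<^sup>2"
    using displacement_le_decrease[OF step[OF T]] descent[OF T] zero_le_power2[of "norm (z (Suc T) - x)"]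
    by linarith
  show ?thesis
  proof (cases "T = 1")
    case True
    then show ?thesis
      using last zero_le_power2[of "norm (z 1 - x)"] unfolding True by linarith
  next
    case False
    with T obtain t where t: "T = Suc t" "t \<ge> 1"
      by (cases T) auto
    have "2 * (real t * (norm (z T - z (Suc T)))\<^sup>2) \<le> 3 * (real t * a t)"
      using mult_left_mono[OF displ[OF t(2)], of "real t"] t by (simp add: algebra_simps)
    moreover have "real T * (norm (z T - z (Suc T)))\<^sup>2 =
        (norm (z T - z (Suc T)))\<^sup>2 + real t * (norm (z T - z (Suc T)))\<^sup>2"
      by (simp add: t algebra_simps)
    ultimately show ?thesis
      using potential[OF t(2)] last zero_le_power2[of "norm (z T - x)"] unfolding t(1) by argo
  qed
qed

end

section \<open>Eigen-decompositions\<close>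

lemma inner_outer: "M \<bullet> outer u v = u \<bullet> (M *v v)"
  by (simp add: inner_vec_def outer_def matrix_vector_mult_def sum_distrib_left ac_simps)

lemma outer_mult_vec: "outer u v *v x = (v \<bullet> x) *\<^sub>R u"
  by (simp add: vec_eq_iff inner_vec_def outer_def matrix_vector_mult_def sum_distrib_left
      sum_distrib_right ac_simps)

lemma subspace_sym_mats: "subspace sym_mats"
  by (auto simp: subspace_def sym_mats_def transpose_def vec_eq_iff)

lemma outer_sym: "outer v v \<in> sym_mats"
  by (simp add: sym_mats_def outer_def transpose_def vec_eq_iff)

lemma sym_mats_inner: "M \<in> sym_mats \<Longrightarrow> (M *v x) \<bullet> y = x \<bullet> (M *v y)"
  by (metis (mono_tags, lifting) dot_lmul_matrix mem_Collect_eq sym_mats_def transpose_matrix_vector)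

lemma sum_mult_vec: "(\<Sum>i\<in>I. f i) *v x = (\<Sum>i\<in>I. f i *v x)"
  for f :: "'i \<Rightarrow> real^'n^'m"
  by (induction I rule: infinite_finite_induct) (simp_all add: matrix_vector_mult_add_rdistrib)

section \<open>Dimension counts and orthonormal families\<close>

lemma dim_Int_ge:
  fixes S T :: "'a::euclidean_space set"
  assumes "subspace S" "subspace T"
  shows "dim S + dim T \<le> DIM('a) + dim (S \<inter> T)"
  using dim_sums_Int[OF assms] dim_subset_UNIV[of "{x + y |x y. x \<in> S \<and> y \<in> T}"] by linarith

text \<open>The family is indexed so that initial and final segments of an ordered eigenbasis can be
  addressed.\<close>

definition orthonormal_on :: "'i set \<Rightarrow> ('i \<Rightarrow> 'a::real_inner) \<Rightarrow> bool" where
  "orthonormal_on I v \<longleftrightarrow> (\<forall>i\<in>I. \<forall>j\<in>I. v i \<bullet> v j = (if i = j then 1 else 0))"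

lemma orthonormal_on_subset: "orthonormal_on I v \<Longrightarrow> J \<subseteq> I \<Longrightarrow> orthonormal_on J v"
  unfolding orthonormal_on_def by blast

lemma orthonormal_onD: "orthonormal_on I v \<Longrightarrow> i \<in> I \<Longrightarrow> j \<in> I \<Longrightarrow> v i \<bullet> v j = (if i = j then 1 else 0)"
  by (auto simp: orthonormal_on_def)

lemma orthonormal_on_inj: "orthonormal_on I v \<Longrightarrow> inj_on v I"
  unfolding orthonormal_on_def by (intro inj_onI) (metis zero_neq_one)

lemma dim_orthonormal_span:
  fixes v :: "'i \<Rightarrow> 'a::euclidean_space"
  assumes "orthonormal_on I v"
  shows "dim (span (v ` I)) = card I"
proof -
  have "independent (v ` I)"
  proof (rule pairwise_orthogonal_independent)
    show "pairwise orthogonal (v ` I)"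
      using assms by (auto simp: pairwise_def orthogonal_def orthonormal_on_def)
    show "0 \<notin> v ` I"
      using assms by (force simp: orthonormal_on_def)
  qed
  then show ?thesis
    by (simp add: dim_eq_card_independent card_image orthonormal_on_inj[OF assms])
qed

text \<open>The remainder is orthogonal to the span of the family, which is the whole space by
  dimension, hence to itself.\<close>

lemma orthonormal_expand:
  fixes v :: "'i \<Rightarrow> 'a::euclidean_space"
  assumes v: "orthonormal_on I v" and I: "finite I" "card I = DIM('a)"
  shows "(\<Sum>i\<in>I. (v i \<bullet> x) *\<^sub>R v i) = x"
proof -
  let ?d = "x - (\<Sum>i\<in>I. (v i \<bullet> x) *\<^sub>R v i)"
  have "?d \<bullet> v j = 0" if "j \<in> I" for j
  proof -
    have "(\<Sum>i\<in>I. (v i \<bullet> x) * (v i \<bullet> v j)) = (\<Sum>i\<in>I. if i = j then v i \<bullet> x else 0)"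
      using v that by (intro sum.cong) (auto simp: orthonormal_onD)
    then show ?thesis
      using that I(1) by (simp add: inner_diff_left inner_sum_left inner_commute[of x])
  qed
  then have "orthogonal ?d y" if "y \<in> span (v ` I)" for y
    using that orthogonal_to_span[of y "v ` I" ?d] by (auto simp: orthogonal_def)
  moreover have "span (v ` I) = UNIV"
    using dim_orthonormal_span[OF v] I(2) dim_eq_full[of "v ` I"] by simp
  ultimately have "orthogonal ?d ?d"
    by blast
  then show ?thesis
    by (simp add: orthogonal_self)
qed

lemma orthonormal_norm:
  fixes v :: "'i \<Rightarrow> 'a::euclidean_space"
  assumes "orthonormal_on I v" "finite I" "card I = DIM('a)"
  shows "(norm x)\<^sup>2 = (\<Sum>i\<in>I. (v i \<bullet> x)\<^sup>2)"
proof -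
  have "(norm x)\<^sup>2 = x \<bullet> (\<Sum>i\<in>I. (v i \<bullet> x) *\<^sub>R v i)"
    by (simp add: orthonormal_expand[OF assms] power2_norm_eq_inner)
  then show ?thesis
    by (simp add: inner_sum_right power2_eq_square inner_commute)
qed

lemma orthonormal_span_inner:
  assumes "orthonormal_on I v" "J \<subseteq> I" "i \<in> I - J" "x \<in> span (v ` J)"
  shows "v i \<bullet> x = 0"
proof -
  have "orthogonal (v i) y" if "y \<in> v ` J" for y
    using assms that by (auto simp: orthogonal_def orthonormal_onD subset_iff)
  then show ?thesis
    using assms(4) orthogonal_to_span unfolding orthogonal_def by blast
qed

section \<open>Quadratic forms in an eigenbasis and uniqueness of eigenvalues\<close>

lemma eigen_decomposition_orthonormal:
  fixes M :: "real^'n^'n"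
  assumes "eigen_decomposition M l v"
  shows "orthonormal_on {1..CARD('n)} v"
  using assms by (simp add: eigen_decomposition_def orthonormal_on_def)

lemma eigen_decomposition_antimono:
  fixes M :: "real^'n^'n"
  assumes "eigen_decomposition M l v" "1 \<le> i" "i \<le> j" "j \<le> CARD('n)"
  shows "l j \<le> l i"
  using assms by (simp add: eigen_decomposition_def)

lemma eigen_decomposition_eq:
  fixes M :: "real^'n^'n"
  assumes "eigen_decomposition M l v"
  shows "M = (\<Sum>i=1..CARD('n). l i *\<^sub>R outer (v i) (v i))"
  using assms by (simp add: eigen_decomposition_def)

lemma eigen_sum_mult_vec:
  fixes v :: "nat \<Rightarrow> real^'n"
  shows "(\<Sum>i\<in>I. l i *\<^sub>R outer (v i) (v i)) *v x = (\<Sum>i\<in>I. (l i * (v i \<bullet> x)) *\<^sub>R v i)"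
  by (simp add: sum_mult_vec outer_mult_vec flip: scaleR_matrix_vector_assoc)

lemma eigen_sum_quadratic:
  fixes v :: "nat \<Rightarrow> real^'n"
  shows "x \<bullet> ((\<Sum>i\<in>I. l i *\<^sub>R outer (v i) (v i)) *v x) = (\<Sum>i\<in>I. l i * (v i \<bullet> x)\<^sup>2)"
  by (simp add: eigen_sum_mult_vec inner_sum_right power2_eq_square inner_commute ac_simps)

text \<open>On this span the coordinates beyond \<open>k\<close> vanish, and all remaining
  eigenvalues are at least \<open>l k\<close>. Together with \<open>eigen_quadratic_le\<close> this
  replaces the Courant-Fischer principle.\<close>

lemma eigen_quadratic_ge:
  fixes M :: "real^'n^'n"
  assumes M: "eigen_decomposition M l v" and k: "1 \<le> k" "k \<le> CARD('n)"
    and x: "x \<in> span (v ` {1..k})"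
  shows "l k * (norm x)\<^sup>2 \<le> x \<bullet> (M *v x)"
proof -
  note v = eigen_decomposition_orthonormal[OF M]
  have "l k * (v i \<bullet> x)\<^sup>2 \<le> l i * (v i \<bullet> x)\<^sup>2" if "i \<in> {1..CARD('n)}" for i
  proof (cases "i \<le> k")
    case True
    then show ?thesis
      using eigen_decomposition_antimono[OF M, of i k] that k by (intro mult_right_mono) auto
  next
    case False
    then show ?thesis
      using orthonormal_span_inner[OF v _ _ x, of i] that k by auto
  qed
  then show ?thesis
    unfolding orthonormal_norm[OF v finite_atLeastAtMost] eigen_decomposition_eq[OF M]
    by (subst orthonormal_norm[OF v]) (auto simp: eigen_sum_quadratic sum_distrib_left intro!: sum_mono)
qed

lemma eigen_quadratic_le:
  fixes M :: "real^'n^'n"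
  assumes M: "eigen_decomposition M l v" and k: "1 \<le> k" "k \<le> CARD('n)"
    and x: "x \<in> span (v ` {k..CARD('n)})"
  shows "x \<bullet> (M *v x) \<le> l k * (norm x)\<^sup>2"
proof -
  note v = eigen_decomposition_orthonormal[OF M]
  have "l i * (v i \<bullet> x)\<^sup>2 \<le> l k * (v i \<bullet> x)\<^sup>2" if "i \<in> {1..CARD('n)}" for i
  proof (cases "k \<le> i")
    case True
    then show ?thesis
      using eigen_decomposition_antimono[OF M, of k i] that k by (intro mult_right_mono) auto
  next
    case False
    then show ?thesis
      using orthonormal_span_inner[OF v _ _ x, of i] that k by auto
  qed
  then show ?thesis
    unfolding eigen_decomposition_eq[OF M]
    by (subst orthonormal_norm[OF v]) (auto simp: eigen_sum_quadratic sum_distrib_left intro!: sum_mono)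
qed

text \<open>Spans of dimensions \<open>i\<close> and \<open>n + 1 - i\<close> share a nonzero
  vector, on which the quadratic form compares the two eigenvalues. By symmetry
  \<open>eigval\<close> is well defined.\<close>

lemma eigenvalues_unique_le:
  fixes M :: "real^'n^'n"
  assumes M: "eigen_decomposition M l v" "eigen_decomposition M l' v'" and i: "1 \<le> i" "i \<le> CARD('n)"
  shows "l i \<le> l' i"
proof -
  let ?S = "span (v ` {1..i})" and ?T = "span (v' ` {i..CARD('n)})"
  have "dim ?S = i" "dim ?T = CARD('n) + 1 - i"
    using i eigen_decomposition_orthonormal[OF M(1)] eigen_decomposition_orthonormal[OF M(2)]
    by (subst dim_orthonormal_span; auto intro: orthonormal_on_subset)+
  then have "0 < dim (?S \<inter> ?T)"
    using dim_Int_ge[of ?S ?T] i by simp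
  then obtain x where x: "x \<in> ?S" "x \<in> ?T" "x \<noteq> 0"
    by (metis (no_types, lifting) IntD1 IntD2 dim_eq_0 less_irrefl singletonI subsetI)
  have "l i * (norm x)\<^sup>2 \<le> l' i * (norm x)\<^sup>2"
    using eigen_quadratic_ge[OF M(1) i x(1)] eigen_quadratic_le[OF M(2) i x(2)] by linarith
  then show ?thesis
    using x(3) by simp
qed

lemma eigval_eq:
  fixes M :: "real^'n^'n"
  assumes "eigen_decomposition M l v" "1 \<le> i" "i \<le> CARD('n)"
  shows "eigval i M = l i"
  unfolding eigval_def
proof (rule the_equality)
  show "\<exists>l' v. eigen_decomposition M l' v \<and> l i = l' i"
    using assms(1) by blast
  show "a = l i" if "\<exists>l v. eigen_decomposition M l v \<and> a = l i" for a
    using that eigenvalues_unique_le assms by (metis order_antisym)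
qed

section \<open>Existence of eigen-decompositions\<close>

lemma quadratic_nonneg_imp_zero:
  fixes a b :: real
  assumes "\<And>t. 0 \<le> 2 * t * a + t\<^sup>2 * b"
  shows "a = 0"
proof (rule ccontr)
  assume a: "a \<noteq> 0"
  define c where "c = 1 + \<bar>b\<bar>"
  have c: "0 < c" "b < c"
    by (auto simp: c_def)
  have "0 \<le> 2 * (- a / c) * a + (- a / c)\<^sup>2 * b"
    by (rule assms)
  also have "\<dots> = a\<^sup>2 * (b - 2 * c) / c\<^sup>2"
    using c by (simp add: field_simps power2_eq_square)
  also have "\<dots> < 0"
    using a c by (intro divide_neg_pos mult_pos_neg) auto
  finally show False
    by simp
qed

text \<open>Perturbing the maximizer along its own defect \<open>h = M *v u - c *\<^sub>R u\<close>
  stays in \<open>W\<close>, since \<open>W\<close> is invariant. The first-order term is then the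
  squared norm of \<open>h\<close>, up to sign and a factor, and must vanish.\<close>

lemma quadratic_form_max_eigenvector:
  fixes M :: "real^'n^'n"
  assumes M: "M \<in> sym_mats" and W: "subspace W" "\<And>x. x \<in> W \<Longrightarrow> M *v x \<in> W"
    and max: "\<And>x. x \<in> W \<Longrightarrow> x \<bullet> (M *v x) \<le> c * (norm x)\<^sup>2"
    and u: "u \<in> W" "u \<bullet> (M *v u) = c * (norm u)\<^sup>2"
  shows "M *v u = c *\<^sub>R u"
proof -
  define h where "h = M *v u - c *\<^sub>R u"
  have h: "h \<in> W"
    unfolding h_def by (intro subspace_diff subspace_scale W u)
  have "- (h \<bullet> h) = 0"
  proof (rule quadratic_nonneg_imp_zero)
    fix t :: real
    have "(u + t *\<^sub>R h) \<bullet> (M *v (u + t *\<^sub>R h)) \<le> c * (norm (u + t *\<^sub>R h))\<^sup>2"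
      by (intro max subspace_add subspace_scale W u h)
    moreover have "(u + t *\<^sub>R h) \<bullet> (M *v (u + t *\<^sub>R h)) =
        c * (norm u)\<^sup>2 + 2 * t * (h \<bullet> (M *v u)) + t\<^sup>2 * (h \<bullet> (M *v h))"
      using sym_mats_inner[OF M, of u h] u(2)
      by (simp add: inner_simps inner_commute[of "M *v u"] matrix_vector_right_distrib
          matrix_vector_mult_scaleR algebra_simps power2_eq_square[of t])
    moreover have "(norm (u + t *\<^sub>R h))\<^sup>2 = (norm u)\<^sup>2 + 2 * t * (h \<bullet> u) + t\<^sup>2 * (h \<bullet> h)"
      by (simp add: power2_norm_eq_inner inner_simps inner_commute algebra_simps power2_eq_square[of t])
    moreover have "h \<bullet> (M *v u) = h \<bullet> h + c * (h \<bullet> u)"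
      by (simp add: h_def inner_diff_right)
    ultimately show "0 \<le> 2 * t * - (h \<bullet> h) + t\<^sup>2 * (c * (h \<bullet> h) - h \<bullet> (M *v h))"
      by (simp add: algebra_simps)
  qed
  then show ?thesis
    by (simp add: h_def)
qed

text \<open>The eigenvectors are found greedily: the next one maximizes the quadratic form on the unit
  sphere of the orthogonal complement of those already chosen.\<close>

lemma partial_eigen_decomposition:
  fixes M :: "real^'n^'n"
  assumes M: "M \<in> sym_mats" and "k \<le> CARD('n)"
  shows "\<exists>l v. orthonormal_on {1..k} v \<and> (\<forall>i\<in>{1..k}. M *v v i = l i *\<^sub>R v i) \<and>
     (\<forall>i\<in>{1..k}. \<forall>j\<in>{1..k}. i \<le> j \<longrightarrow> l j \<le> l i) \<and>
     (\<forall>x. (\<forall>j\<in>{1..k}. v j \<bullet> x = 0) \<longrightarrow> (\<forall>i\<in>{1..k}. x \<bullet> (M *v x) \<le> l i * (norm x)\<^sup>2))"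
  using assms(2)
proof (induction k)
  case 0
  then show ?case
    by (auto simp: orthonormal_on_def)
next
  case (Suc k)
  from Suc.prems have "k \<le> CARD('n)"
    by simp
  from Suc.IH[OF this] obtain l :: "nat \<Rightarrow> real" and v :: "nat \<Rightarrow> real^'n"
    where v: "orthonormal_on {1..k} v" and eig: "\<forall>i\<in>{1..k}. M *v v i = l i *\<^sub>R v i"
    and anti: "\<forall>i\<in>{1..k}. \<forall>j\<in>{1..k}. i \<le> j \<longrightarrow> l j \<le> l i"
    and "\<forall>x. (\<forall>j\<in>{1..k}. v j \<bullet> x = 0) \<longrightarrow> (\<forall>i\<in>{1..k}. x \<bullet> (M *v x) \<le> l i * (norm x)\<^sup>2)"
    by (elim exE conjE)
  note bound = this(4)[rule_format]
  define W where "W = {x. \<forall>j\<in>{1..k}. v j \<bullet> x = 0}"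
  have W: "subspace W"
    by (auto simp: W_def subspace_def inner_simps)
  have W_M: "M *v x \<in> W" if "x \<in> W" for x
    using that eig by (auto simp: W_def simp flip: sym_mats_inner[OF M])
  have "closed W"
    using W by (rule closed_subspace)
  then have "compact (sphere 0 1 \<inter> W)"
    by (intro compact_Int_closed) auto
  moreover have "sphere 0 1 \<inter> W \<noteq> {}"
  proof -
    have "dim (v ` {1..k}) < DIM(real^'n)"
      using dim_orthonormal_span[OF v] Suc.prems by simp
    then obtain x where x: "x \<noteq> 0" "\<And>y. y \<in> span (v ` {1..k}) \<Longrightarrow> orthogonal x y"
      using orthogonal_to_subspace_exists[of "v ` {1..k}"] by blast
    then have "x \<in> W"
      by (auto simp: W_def orthogonal_def inner_commute[of _ x] span_base)
    then have "(1 / norm x) *\<^sub>R x \<in> sphere 0 1 \<inter> W"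
      using x(1) subspace_scale[OF W, of x "1 / norm x"] by simp
    then show ?thesis
      by blast
  qed
  moreover have "continuous_on (sphere 0 1 \<inter> W) (\<lambda>x. x \<bullet> (M *v x))"
    by (intro continuous_intros linear_continuous_on matrix_vector_mul_bounded_linear)
  ultimately obtain u where u: "u \<in> sphere 0 1 \<inter> W"
    and u_max: "\<And>x. x \<in> sphere 0 1 \<inter> W \<Longrightarrow> x \<bullet> (M *v x) \<le> u \<bullet> (M *v u)"
    using continuous_attains_sup[of "sphere 0 1 \<inter> W" "\<lambda>x. x \<bullet> (M *v x)"] by blast
  define c where "c = u \<bullet> (M *v u)"
  have bound_c: "x \<bullet> (M *v x) \<le> c * (norm x)\<^sup>2" if "x \<in> W" for x
  proof (cases "x = 0")
    case False
    then have "(1 / norm x) *\<^sub>R x \<in> sphere 0 1 \<inter> W"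
      using that subspace_scale[OF W, of x "1 / norm x"] by simp
    then have "((1 / norm x) *\<^sub>R x) \<bullet> (M *v ((1 / norm x) *\<^sub>R x)) \<le> c"
      unfolding c_def by (rule u_max)
    then have "x \<bullet> (M *v x) / (norm x)\<^sup>2 \<le> c"
      by (simp add: matrix_vector_mult_scaleR power2_eq_square)
    then show ?thesis
      using False by (simp add: field_simps)
  qed simp
  have eig_u: "M *v u = c *\<^sub>R u"
    using u by (intro quadratic_form_max_eigenvector[OF M W W_M bound_c]) (auto simp: c_def)
  \<comment> \<open>This is what the last conjunct of the induction claim is for: \<open>u\<close>
    is orthogonal to the earlier vectors, so every earlier eigenvalue bounds its quadratic
    form.\<close>
  have c_le: "c \<le> l i" if "i \<in> {1..k}" for i
    using bound[of u i] u that by (auto simp: c_def W_def)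
  define l' where "l' = l(Suc k := c)"
  define v' where "v' = v(Suc k := u)"
  have "orthonormal_on {1..Suc k} v'"
    using v u by (auto simp: orthonormal_on_def v'_def W_def inner_commute le_Suc_eq norm_eq_1)
  moreover have "\<forall>i\<in>{1..Suc k}. M *v v' i = l' i *\<^sub>R v' i"
    using eig eig_u by (auto simp: l'_def v'_def)
  moreover have "\<forall>i\<in>{1..Suc k}. \<forall>j\<in>{1..Suc k}. i \<le> j \<longrightarrow> l' j \<le> l' i"
    using anti c_le by (auto simp: l'_def)
  moreover have "x \<bullet> (M *v x) \<le> l' i * (norm x)\<^sup>2"
    if x: "\<forall>j\<in>{1..Suc k}. v' j \<bullet> x = 0" and i: "i \<in> {1..Suc k}" for x i
  proof -
    have "v j \<bullet> x = 0" if "j \<in> {1..k}" for j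
      using x[rule_format, of j] that by (auto simp: v'_def)
    then show ?thesis
      using bound[of x i] bound_c[of x] i by (auto simp: l'_def W_def le_Suc_eq)
  qed
  ultimately show ?case
    by blast
qed

theorem eigen_decomposition_exists:
  fixes M :: "real^'n^'n"
  assumes "M \<in> sym_mats"
  shows "\<exists>l v. eigen_decomposition M l v"
proof -
  obtain l :: "nat \<Rightarrow> real" and v :: "nat \<Rightarrow> real^'n"
    where v: "orthonormal_on {1..CARD('n)} v" and eig: "\<forall>i\<in>{1..CARD('n)}. M *v v i = l i *\<^sub>R v i"
    and anti: "\<forall>i\<in>{1..CARD('n)}. \<forall>j\<in>{1..CARD('n)}. i \<le> j \<longrightarrow> l j \<le> l i"
    using partial_eigen_decomposition[OF assms order_refl] by blast
  have "M *v x = (\<Sum>i=1..CARD('n). l i *\<^sub>R outer (v i) (v i)) *v x" for x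
  proof -
    have "M *v x = M *v (\<Sum>i=1..CARD('n). (v i \<bullet> x) *\<^sub>R v i)"
      using orthonormal_expand[OF v, of x] by simp
    also have "\<dots> = (\<Sum>i=1..CARD('n). (l i * (v i \<bullet> x)) *\<^sub>R v i)"
      using eig by (simp add: linear_sum[OF matrix_vector_mul_linear] matrix_vector_mult_scaleR
          mult.commute)
    finally show ?thesis
      by (simp only: eigen_sum_mult_vec)
  qed
  then have "M = (\<Sum>i=1..CARD('n). l i *\<^sub>R outer (v i) (v i))"
    by (simp add: matrix_eq)
  then show ?thesis
    using v anti unfolding eigen_decomposition_def orthonormal_on_def by blast
qed

section \<open>Projections onto the positive semidefinite cone\<close>

text \<open>As an intersection of a subspace with half-spaces, the cone is visibly closed and
  convex.\<close>

lemma psd_cone_eq: "psd_cone = sym_mats \<inter> (\<Inter>x. {M. outer x x \<bullet> M \<ge> 0})"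
  by (auto simp: psd_cone_def inner_outer inner_commute[of "outer _ _"])

lemma psd_coneD: "M \<in> psd_cone \<Longrightarrow> M \<in> sym_mats" "M \<in> psd_cone \<Longrightarrow> 0 \<le> x \<bullet> (M *v x)"
  by (auto simp: psd_cone_def)

lemma closed_psd_cone: "closed psd_cone"
  unfolding psd_cone_eq
  by (intro closed_Int closed_INT ballI closed_halfspace_ge[simplified] closed_subspace subspace_sym_mats
      closed_Collect_le continuous_intros)

lemma convex_psd_cone: "convex psd_cone"
  unfolding psd_cone_eq
  by (intro convex_Int[OF subspace_imp_convex[OF subspace_sym_mats]] convex_INT)
    (rule convex_halfspace_ge[where b = 0, simplified])

lemma psd_cone_add: "M \<in> psd_cone \<Longrightarrow> N \<in> psd_cone \<Longrightarrow> M + N \<in> psd_cone"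
  by (auto simp: psd_cone_def subspace_add[OF subspace_sym_mats] matrix_vector_mult_add_rdistrib inner_add_right)

lemma psd_cone_scale: "M \<in> psd_cone \<Longrightarrow> 0 \<le> c \<Longrightarrow> c *\<^sub>R M \<in> psd_cone"
  by (auto simp: psd_cone_def subspace_scale[OF subspace_sym_mats] simp flip: scaleR_matrix_vector_assoc)

lemma zero_in_psd_cone: "0 \<in> psd_cone"
  by (simp add: psd_cone_def subspace_0[OF subspace_sym_mats])

lemma psd_cone_sum: "(\<And>i. i \<in> I \<Longrightarrow> f i \<in> psd_cone) \<Longrightarrow> (\<Sum>i\<in>I. f i) \<in> psd_cone"
  by (induction I rule: infinite_finite_induct) (auto intro: psd_cone_add zero_in_psd_cone)

lemma outer_in_psd_cone: "outer v v \<in> psd_cone"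
  by (simp add: psd_cone_def outer_sym outer_mult_vec inner_commute)

lemma psd_eigenvalue_nonneg:
  fixes M :: "real^'n^'n"
  assumes "M \<in> psd_cone" and M: "eigen_decomposition M l v" and i: "i \<in> {1..CARD('n)}"
  shows "0 \<le> l i"
proof -
  have "v i \<in> span (v ` {i..CARD('n)})"
    using i by (intro span_base) auto
  with i have "v i \<bullet> (M *v v i) \<le> l i * (norm (v i))\<^sup>2"
    by (intro eigen_quadratic_le[OF M]) auto
  moreover have "norm (v i) = 1"
    using eigen_decomposition_orthonormal[OF M] i by (simp add: norm_eq_1 orthonormal_onD)
  ultimately show ?thesis
    using psd_coneD(2)[OF assms(1), of "v i"] by simp
qed

lemma inner_eigen_sum:
  "P \<bullet> (\<Sum>i\<in>I. l i *\<^sub>R outer (v i) (v i)) = (\<Sum>i\<in>I. l i * (v i \<bullet> (P *v v i)))"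
  by (simp add: inner_sum_right inner_outer)

text \<open>A zero of the nonnegative form is a minimizer; moving from it along
  \<open>P *v u\<close> gives a first-order term proportional to the squared norm of
  \<open>P *v u\<close>.\<close>

lemma psd_form_zero_imp_kernel:
  assumes P: "P \<in> psd_cone" and "u \<bullet> (P *v u) = 0"
  shows "P *v u = 0"
proof -
  define h where "h = P *v u"
  have "h \<bullet> h = 0"
  proof (rule quadratic_nonneg_imp_zero)
    fix t :: real
    have "u \<bullet> (P *v h) = h \<bullet> h"
      using sym_mats_inner[OF psd_coneD(1)[OF P], of u h] by (simp add: h_def)
    then show "0 \<le> 2 * t * (h \<bullet> h) + t\<^sup>2 * (h \<bullet> (P *v h))"
      using psd_coneD(2)[OF P, of "u + t *\<^sub>R h"] assms(2)
      by (simp add: inner_simps matrix_vector_right_distrib matrix_vector_mult_scaleR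
          power2_eq_square algebra_simps flip: h_def)
  qed
  then show ?thesis
    by (simp add: h_def)
qed

text \<open>Moreau decomposition: \<open>M - ?Y\<close> is the negative part of \<open>M\<close>,
  orthogonal to \<open>?Y\<close> and with nonpositive product with every element of the
  cone.\<close>

lemma closest_point_psd_cone:
  fixes M :: "real^'n^'n"
  assumes M: "eigen_decomposition M l v"
  shows "closest_point psd_cone M = (\<Sum>i=1..CARD('n). max (l i) 0 *\<^sub>R outer (v i) (v i))"
    (is "_ = ?Y")
proof -
  note v = eigen_decomposition_orthonormal[OF M]
  have Y: "?Y \<in> psd_cone"
    by (intro psd_cone_sum psd_cone_scale outer_in_psd_cone) simp
  have diff: "M - ?Y = (\<Sum>i=1..CARD('n). min (l i) 0 *\<^sub>R outer (v i) (v i))"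
    by (subst eigen_decomposition_eq[OF M])
      (auto simp: min_def max_def simp flip: sum_subtractf scaleR_left_diff_distrib intro!: sum.cong)
  have "(M - ?Y) \<bullet> ?Y = 0"
  proof -
    have "v i \<bullet> (?Y *v v i) = max (l i) 0" if "i \<in> {1..CARD('n)}" for i
    proof -
      have "v i \<bullet> (?Y *v v i) = (\<Sum>j=1..CARD('n). if j = i then max (l i) 0 else 0)"
        unfolding eigen_sum_quadratic using that v by (intro sum.cong) (auto simp: orthonormal_onD)
      then show ?thesis
        using that by simp
    qed
    then have "?Y \<bullet> (M - ?Y) = (\<Sum>i=1..CARD('n). min (l i) 0 * max (l i) 0)"
      unfolding diff inner_eigen_sum by (intro sum.cong) auto
    then show ?thesis
      by (auto simp: inner_commute min_def max_def intro!: sum.neutral)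
  qed
  moreover have "(M - ?Y) \<bullet> P \<le> 0" if "P \<in> psd_cone" for P
    unfolding diff inner_commute[of _ P] inner_eigen_sum
    using psd_coneD(2)[OF that] by (intro sum_nonpos mult_nonpos_nonneg) auto
  ultimately have "dist M ?Y \<le> dist M P" if "P \<in> psd_cone" for P
  proof -
    have "(norm (M - P))\<^sup>2 = (norm (M - ?Y))\<^sup>2 + (norm (?Y - P))\<^sup>2 + 2 * ((M - ?Y) \<bullet> ?Y) - 2 * ((M - ?Y) \<bullet> P)"
      by (simp add: power2_norm_eq_inner inner_simps inner_commute)
    then have "(norm (M - ?Y))\<^sup>2 \<le> (norm (M - P))\<^sup>2"
      using \<open>(M - ?Y) \<bullet> ?Y = 0\<close> \<open>\<And>P. P \<in> psd_cone \<Longrightarrow> (M - ?Y) \<bullet> P \<le> 0\<close>[OF that]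
        zero_le_power2[of "norm (?Y - P)"] by linarith
    then show ?thesis
      by (simp add: dist_norm)
  qed
  then show ?thesis
    using closest_point_unique[OF convex_psd_cone closed_psd_cone Y] by auto
qed

text \<open>The dropped terms are zero in every eigen-decomposition of \<open>M\<close>, so here the
  relation does not depend on the chosen one.\<close>

lemma trunc_psd_proj_iff:
  fixes M :: "real^'n^'n"
  assumes M: "M \<in> sym_mats" and r: "r < CARD('n)" and nonpos: "eigval (r + 1) M \<le> 0"
  shows "trunc_psd_proj r M Y \<longleftrightarrow> psd_proj M Y"
proof -
  have trunc: "(\<Sum>i=1..r. max (l i) 0 *\<^sub>R outer (v i) (v i)) = closest_point psd_cone M"
    if "eigen_decomposition M l v" for l v
    unfolding closest_point_psd_cone[OF that]
  proof (rule sum.mono_neutral_left)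
    have "l i \<le> 0" if "i \<in> {1..CARD('n)} - {1..r}" for i
      using eigen_decomposition_antimono[OF \<open>eigen_decomposition M l v\<close>, of "r + 1" i] that r nonpos
        eigval_eq[OF \<open>eigen_decomposition M l v\<close>, of "r + 1"] by auto
    then show "\<forall>i\<in>{1..CARD('n)} - {1..r}. max (l i) 0 *\<^sub>R outer (v i) (v i) = 0"
      by (auto simp: max_absorb2)
  qed (use r in auto)
  obtain l v where "eigen_decomposition M l v"
    using eigen_decomposition_exists[OF M] by blast
  with trunc show ?thesis
    unfolding trunc_psd_proj_def psd_proj_def by (auto intro!: exI[of _ l] exI[of _ v])
qed

text \<open>Otherwise all eigenvalues from \<open>k\<close> on vanish and the range lies in the span
  of the first \<open>k - 1\<close> eigenvectors.\<close>

lemma psd_eigenvalue_pos_le_rank: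
  fixes H :: "real^'n^'n"
  assumes "H \<in> psd_cone" and H: "eigen_decomposition H h u" and k: "1 \<le> k" "k \<le> rank H"
  shows "0 < h k"
proof (rule ccontr)
  assume "\<not> 0 < h k"
  have kn: "k \<le> CARD('n)"
    using k rank_bound[of H] by simp
  have zero: "h i = 0" if "i \<in> {k..CARD('n)}" for i
    using psd_eigenvalue_nonneg[OF assms(1) H, of i] eigen_decomposition_antimono[OF H, of k i]
      that k \<open>\<not> 0 < h k\<close> by auto
  have "H *v x \<in> span (u ` {1..<k})" for x
  proof -
    have "(h i * (u i \<bullet> x)) *\<^sub>R u i \<in> span (u ` {1..<k})" if "i \<in> {1..CARD('n)}" for i
    proof (cases "i < k")
      case True
      with that have "u i \<in> u ` {1..<k}"
        by auto
      then show ?thesis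
        by (intro span_scale span_base)
    qed (use that zero in \<open>auto intro: span_zero\<close>)
    then show ?thesis
      by (subst eigen_decomposition_eq[OF H]) (auto simp: eigen_sum_mult_vec intro: span_sum)
  qed
  then have "rank H \<le> dim (span (u ` {1..<k}))"
    unfolding rank_dim_range by (intro dim_subset) auto
  also have "\<dots> = k - 1"
    using kn by (subst dim_orthonormal_span)
      (auto intro: orthonormal_on_subset[OF eigen_decomposition_orthonormal[OF H]])
  finally show False
    using k by simp
qed

text \<open>With \<open>P\<close> primal optimal and \<open>H\<close> the gradient of the Lagrangian there, \<open>P - \<eta> H\<close> is the fixed
  point of the projection step.\<close>

lemma eigenvalue_nonpos_near:
  fixes M P H :: "real^'n^'n"
  assumes M: "eigen_decomposition M l v" and H: "eigen_decomposition H h u"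
    and psd: "P \<in> psd_cone" "H \<in> psd_cone" and PH: "P \<bullet> H = 0" and \<eta>: "0 < \<eta>"
    and r: "r < CARD('n)" and p: "1 \<le> p" "p \<le> r + 1" and k: "k + r + 1 = CARD('n) + p"
    and hk: "0 < h k" and near: "norm (M - (P - \<eta> *\<^sub>R H)) \<le> \<eta> * (sqrt (real p) * h k)"
  shows "l (r + 1) \<le> 0"
proof (rule ccontr)
  assume pos: "\<not> l (r + 1) \<le> 0"
  have k1: "1 \<le> k" "k \<le> CARD('n)"
    using k p r by linarith+
  define D where "D = M - (P - \<eta> *\<^sub>R H)"
  let ?S = "span (v ` {1..r + 1})" and ?T = "span (u ` {1..k})"
  have "dim ?S = r + 1" "dim ?T = k"
    using r k1 eigen_decomposition_orthonormal[OF M] eigen_decomposition_orthonormal[OF H]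
    by (subst dim_orthonormal_span; auto intro: orthonormal_on_subset)+
  \<comment> \<open>The index \<open>k\<close> is chosen so that \<open>(r + 1) + k - n\<close>
    equals \<open>p\<close>.\<close>
  then have dim: "p \<le> dim (?S \<inter> ?T)"
    using dim_Int_ge[of ?S ?T] k by simp
  obtain B where B: "B \<subseteq> ?S \<inter> ?T" "pairwise orthogonal B" "\<And>x. x \<in> B \<Longrightarrow> norm x = 1"
    "card B = dim (?S \<inter> ?T)"
    using orthonormal_basis_subspace[of "?S \<inter> ?T"] by (metis subspace_Int subspace_span subspace_inter)
  obtain B' where B': "B' \<subseteq> B" "card B' = p" "finite B'"
    using obtain_subset_with_card_n[of p B] dim B(4) by metis
  \<comment> \<open>Complementary slackness: \<open>P \<bullet> H = 0\<close> is a sum of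
    nonnegative terms with weights \<open>h i\<close>, and these weights are positive for
    \<open>i \<le> k\<close>.\<close>
  have kernel: "P *v x = 0" if "x \<in> ?T" for x
  proof -
    have "(\<Sum>i=1..CARD('n). h i * (u i \<bullet> (P *v u i))) = 0"
      using PH unfolding inner_eigen_sum[symmetric] eigen_decomposition_eq[OF H, symmetric] .
    then have "h i * (u i \<bullet> (P *v u i)) = 0" if "i \<in> {1..CARD('n)}" for i
      using that psd_eigenvalue_nonneg[OF psd(2) H] psd_coneD(2)[OF psd(1)]
      by (subst (asm) sum_nonneg_eq_0_iff) auto
    moreover have "h i \<noteq> 0" if "i \<in> {1..k}" for i
      using eigen_decomposition_antimono[OF H, of i k] that k1 hk by auto
    ultimately have "P *v u i = 0" if "i \<in> {1..k}" for i
      using that k1 by (intro psd_form_zero_imp_kernel[OF psd(1)]) force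
    then have "u ` {1..k} \<subseteq> {x. P *v x = 0}"
      by auto
    then have "?T \<subseteq> {x. P *v x = 0}"
      by (intro span_minimal)
        (auto simp: subspace_def matrix_vector_right_distrib matrix_vector_mult_scaleR)
    with that show ?thesis
      by auto
  qed
  have large: "\<eta> * h k < x \<bullet> (D *v x)" if "x \<in> B'" for x
  proof -
    have x: "x \<in> ?S" "x \<in> ?T" "norm x = 1"
      using that B B' by auto
    have "0 < x \<bullet> (M *v x)"
      using eigen_quadratic_ge[OF M _ _ x(1)] pos r x(3) by simp
    moreover have "\<eta> * h k \<le> \<eta> * (x \<bullet> (H *v x))"
      using eigen_quadratic_ge[OF H k1 x(2)] \<eta> x(3) by simp
    ultimately show ?thesis
      using kernel[OF x(2)]
      by (simp add: D_def matrix_vector_mult_diff_rdistrib inner_diff_right inner_add_right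
          flip: scaleR_matrix_vector_assoc)
  qed
  \<comment> \<open>\<open>E\<close> is the orthogonal projection onto the span of
    \<open>B'\<close>, of Frobenius norm \<open>sqrt p\<close>, while \<open>D \<bullet> E\<close>
    adds up \<open>p\<close> values of the quadratic form of \<open>D\<close>. Cauchy-Schwarz
    therefore gains a factor \<open>sqrt p\<close>.\<close>
  define E where "E = (\<Sum>x\<in>B'. outer x x)"
  have "D \<bullet> E = (\<Sum>x\<in>B'. x \<bullet> (D *v x))"
    by (simp add: E_def inner_sum_right inner_outer)
  also have "\<dots> > (\<Sum>x\<in>B'. \<eta> * h k)"
    using large B'(2,3) p by (intro sum_strict_mono) auto
  finally have "real p * (\<eta> * h k) < D \<bullet> E"
    using B' by simp
  also have "D \<bullet> E \<le> norm D * norm E"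
    by (rule norm_cauchy_schwarz)
  also have "norm E = sqrt (real p)"
  proof -
    have "x \<bullet> (E *v x) = 1" if "x \<in> B'" for x
    proof -
      have "x \<bullet> (E *v x) = (\<Sum>y\<in>B'. (x \<bullet> y)\<^sup>2)"
        by (simp add: E_def sum_mult_vec outer_mult_vec inner_sum_right power2_eq_square inner_commute)
      also have "\<dots> = (\<Sum>y\<in>B'. if y = x then 1 else 0)"
        using that B(2,3) B'(1) by (intro sum.cong) (auto simp: pairwise_def orthogonal_def norm_eq_1 subset_iff)
      finally show ?thesis
        using that B'(3) by simp
    qed
    then have "E \<bullet> E = real p"
      using B'(2) by (subst (2) E_def) (simp add: inner_sum_right inner_outer)
    then show ?thesis
      by (simp add: norm_eq_sqrt_inner)
  qed
  also have "norm D * sqrt (real p) \<le> \<eta> * (sqrt (real p) * h k) * sqrt (real p)"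
    using near by (intro mult_right_mono) (auto simp: D_def)
  also have "\<dots> = real p * (\<eta> * h k)"
    by simp
  finally show False
    by simp
qed

section \<open>The saddle operator of the Lagrangian\<close>

text \<open>The difference quotients are one-sided and along a segment inside \<open>S\<close>, so
  that \<open>S\<close> may have empty interior in the ambient space, as \<open>sym_mats\<close> and
  \<open>K\<close> may.\<close>

lemma has_derivative_segment_tendsto:
  fixes \<phi> :: "'a::real_normed_vector \<Rightarrow> real"
  assumes S: "convex S" "x \<in> S" "y \<in> S" and D: "(\<phi> has_derivative D) (at x within S)"
  shows "((\<lambda>t. (\<phi> ((1 - t) *\<^sub>R x + t *\<^sub>R y) - \<phi> x) / t) \<longlongrightarrow> D (y - x)) (at 0 within {0..1})"
proof -
  let ?c = "\<lambda>t. (1 - t) *\<^sub>R x + t *\<^sub>R y"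
  have c: "(?c has_derivative (\<lambda>t. t *\<^sub>R (y - x))) (at 0 within {0..1})"
    by (auto intro!: derivative_eq_intros simp: algebra_simps)
  have "?c ` {0..1} \<subseteq> S"
    using S by (auto simp: convex_alt)
  then have "(\<phi> has_derivative D) (at (?c 0) within ?c ` {0..1})"
    using D by (auto intro: has_derivative_subset)
  from has_derivative_in_compose[OF c this]
  have "((\<lambda>t. \<phi> (?c t)) has_derivative (\<lambda>t. D (t *\<^sub>R (y - x)))) (at 0 within {0..1})" .
  moreover have "D (t *\<^sub>R (y - x)) = D (y - x) * t" for t
    using has_derivative_linear[OF D] by (simp add: linear_cmul)
  ultimately show ?thesis
    by (simp add: has_field_derivative_iff flip: has_field_derivative_def)
qed

lemma convex_on_gradient_le:
  fixes \<phi> :: "'a::real_normed_vector \<Rightarrow> real"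
  assumes \<phi>: "convex_on S \<phi>" and x: "x \<in> S" "y \<in> S" and D: "(\<phi> has_derivative D) (at x within S)"
  shows "\<phi> x + D (y - x) \<le> \<phi> y"
proof -
  have S: "convex S"
    using \<phi> by (rule convex_on_imp_convex)
  have "D (y - x) \<le> \<phi> y - \<phi> x"
  proof (rule tendsto_upperbound[OF has_derivative_segment_tendsto[OF S x D]])
    have "(\<phi> ((1 - t) *\<^sub>R x + t *\<^sub>R y) - \<phi> x) / t \<le> \<phi> y - \<phi> x" if "t \<in> {0..1}" "t \<noteq> 0" for t
    proof -
      have "\<phi> ((1 - t) *\<^sub>R x + t *\<^sub>R y) \<le> (1 - t) * \<phi> x + t * \<phi> y"
        using that x by (intro convex_onD[OF \<phi>]) auto
      then show ?thesis
        using that by (simp add: field_simps)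
    qed
    then show "\<forall>\<^sub>F t in at 0 within {0..1}. (\<phi> ((1 - t) *\<^sub>R x + t *\<^sub>R y) - \<phi> x) / t \<le> \<phi> y - \<phi> x"
      by (auto simp: eventually_at_filter)
    show "at (0::real) within {0..1} \<noteq> bot"
      by (simp add: at_within_Icc_at_right)
  qed
  then show ?thesis
    by simp
qed

lemma min_on_gradient_ge:
  fixes \<phi> :: "'a::real_normed_vector \<Rightarrow> real"
  assumes S: "convex S" "x \<in> S" "y \<in> S" and D: "(\<phi> has_derivative D) (at x within S)"
    and min: "\<And>v. v \<in> S \<Longrightarrow> \<phi> x \<le> \<phi> v"
  shows "0 \<le> D (y - x)"
proof (rule tendsto_lowerbound[OF has_derivative_segment_tendsto[OF S D]])
  have "0 \<le> (\<phi> ((1 - t) *\<^sub>R x + t *\<^sub>R y) - \<phi> x) / t" if "t \<in> {0..1}" for t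
    using that S by (auto intro!: divide_nonneg_nonneg min simp: convex_alt)
  then show "\<forall>\<^sub>F t in at 0 within {0..1}. 0 \<le> (\<phi> ((1 - t) *\<^sub>R x + t *\<^sub>R y) - \<phi> x) / t"
    by (auto simp: eventually_at_filter)
  show "at (0::real) within {0..1} \<noteq> bot"
    by (simp add: at_within_Icc_at_right)
qed

section \<open>Partial gradients and the operator norm of the constraint map\<close>

lemma partial_gradient_X:
  assumes "are_partial_gradients K G GX Gl" "M \<in> sym_mats" "p \<in> K"
  shows "((\<lambda>M. G M p) has_derivative (\<lambda>H. GX M p \<bullet> H)) (at M within sym_mats)"
proof -
  have "((\<lambda>(X, l). G X l) has_derivative (\<lambda>(H, h). GX M p \<bullet> H + Gl M p \<bullet> h))
      (at (M, p) within (\<lambda>M. (M, p)) ` sym_mats)"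
    using assms by (auto simp: are_partial_gradients_def intro: has_derivative_subset)
  moreover have "((\<lambda>M. (M, p)) has_derivative (\<lambda>H. (H, 0))) (at M within sym_mats)"
    by (intro derivative_intros)
  ultimately show ?thesis
    by (auto dest: has_derivative_in_compose[rotated])
qed

lemma partial_gradient_l:
  assumes "are_partial_gradients K G GX Gl" "M \<in> sym_mats" "p \<in> K"
  shows "(G M has_derivative (\<lambda>h. Gl M p \<bullet> h)) (at p within K)"
proof -
  have "((\<lambda>(X, l). G X l) has_derivative (\<lambda>(H, h). GX M p \<bullet> H + Gl M p \<bullet> h))
      (at (M, p) within (\<lambda>p. (M, p)) ` K)"
    using assms by (auto simp: are_partial_gradients_def intro: has_derivative_subset)
  moreover have "((\<lambda>p. (M, p)) has_derivative (\<lambda>h. (0, h))) (at p within K)"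
    by (intro derivative_intros)
  ultimately show ?thesis
    by (auto dest: has_derivative_in_compose[rotated])
qed

lemma adj_map_diff: "adj_map A y - adj_map A y' = adj_map A (y - y')"
  by (simp add: adj_map_def scaleR_left_diff_distrib sum_subtractf)

lemma lin_map_diff: "lin_map A X - lin_map A Y = lin_map A (X - Y)"
  by (simp add: lin_map_def vec_eq_iff inner_diff_left)

lemma norm_lin_map_le:
  assumes X: "X \<in> sym_mats"
  shows "norm (lin_map A X) \<le> map_norm A * norm X"
proof (cases "X = 0")
  case True
  then show ?thesis
    by (simp add: linear_0[OF bounded_linear.linear[OF bounded_linear_lin_map]])
next
  case False
  interpret lin: bounded_linear "lin_map A"
    by (rule bounded_linear_lin_map)
  obtain B where B: "\<And>X. norm (lin_map A X) \<le> norm X * B" "B \<ge> 0"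
    using lin.nonneg_bounded by blast
  let ?Y = "(1 / norm X) *\<^sub>R X"
  have "norm (lin_map A ?Y) \<le> map_norm A"
    unfolding map_norm_def
  proof (rule cSUP_upper)
    show "?Y \<in> {X \<in> sym_mats. norm X \<le> 1}"
      using X False by (auto intro: subspace_scale[OF subspace_sym_mats])
    show "bdd_above ((\<lambda>X. norm (lin_map A X)) ` {X \<in> sym_mats. norm X \<le> 1})"
      using B by (intro bdd_aboveI2[where M = B])
        (metis (no_types, lifting) mem_Collect_eq mult_left_le_one_le mult_right_mono mult_1 norm_ge_zero order_trans)
  qed
  then show ?thesis
    using False by (simp add: lin.scaleR field_simps)
qed

lemma map_norm_nonneg:
  fixes A :: "'m::finite \<Rightarrow> real^'n^'n"
  shows "0 \<le> map_norm A"
proof -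
  have "norm (lin_map A (mat 1 :: real^'n^'n)) \<le> map_norm A * norm (mat 1 :: real^'n^'n)"
    by (rule norm_lin_map_le) (auto simp: sym_mats_def)
  then have "0 \<le> map_norm A * norm (mat 1 :: real^'n^'n)"
    using norm_ge_zero order_trans by blast
  moreover have "0 < norm (mat 1 :: real^'n^'n)"
    by (auto simp: vec_eq_iff mat_def)
  ultimately show ?thesis
    by (simp add: zero_le_mult_iff)
qed

text \<open>The squared norm of \<open>adj_map A y\<close> is
  \<open>y \<bullet> lin_map A (adj_map A y)\<close>. Symmetry of the \<open>A i\<close> puts
  \<open>adj_map A y\<close> in the space over which \<open>map_norm\<close> is taken.\<close>

lemma norm_adj_map_le:
  assumes "\<And>i. A i \<in> sym_mats"
  shows "norm (adj_map A y) \<le> map_norm A * norm y"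
proof (cases "adj_map A y = 0")
  case True
  then show ?thesis
    using map_norm_nonneg[of A] by simp
next
  case False
  have "adj_map A y \<in> sym_mats"
    unfolding adj_map_def by (intro subspace_sum subspace_scale subspace_sym_mats assms)
  then have "norm y * norm (lin_map A (adj_map A y)) \<le> norm y * (map_norm A * norm (adj_map A y))"
    by (intro mult_left_mono norm_lin_map_le) auto
  moreover have "(norm (adj_map A y))\<^sup>2 \<le> norm y * norm (lin_map A (adj_map A y))"
    using norm_cauchy_schwarz[of y "lin_map A (adj_map A y)"]
    by (simp add: inner_lin_map power2_norm_eq_inner)
  ultimately have "norm (adj_map A y) * norm (adj_map A y) \<le> (map_norm A * norm y) * norm (adj_map A y)"
    by (simp add: power2_eq_square ac_simps)
  then show ?thesis
    using False by simp
qed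

section \<open>The saddle problem and its operator\<close>

lemma norm_triple: "(norm (a, b, c))\<^sup>2 = (norm a)\<^sup>2 + (norm b)\<^sup>2 + (norm c)\<^sup>2"
  by (simp add: norm_prod_def)

text \<open>The step-size bounds appear squared and free of division, as
  \<open>step_bound_imp\<close> delivers them.\<close>

locale saddle_problem =
  fixes f :: "real^'n^'n \<Rightarrow> real" and gradf :: "real^'n^'n \<Rightarrow> real^'n^'n"
    and G :: "real^'n^'n \<Rightarrow> 'e::euclidean_space \<Rightarrow> real"
    and GX :: "real^'n^'n \<Rightarrow> 'e \<Rightarrow> real^'n^'n" and Gl :: "real^'n^'n \<Rightarrow> 'e \<Rightarrow> 'e"
    and K :: "'e set" and A :: "'m::finite \<Rightarrow> real^'n^'n" and b :: "real^'m"
    and \<beta> \<rho>X \<rho>l \<rho>Xl \<rho>lX \<eta> :: real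
  assumes f_convex: "convex_on sym_mats f"
    and f_grad: "is_gradient_sym f gradf"
    and f_smooth: "\<beta>-lipschitz_on sym_mats gradf"
    and A_sym: "\<And>i. A i \<in> sym_mats"
    and K: "compact K" "convex K"
    and G_convex: "\<And>p. p \<in> K \<Longrightarrow> convex_on sym_mats (\<lambda>M. G M p)"
    and G_concave: "\<And>M. M \<in> psd_cone \<Longrightarrow> concave_on K (G M)"
    and G_grad: "are_partial_gradients K G GX Gl"
    and \<rho>X: "\<And>p. p \<in> K \<Longrightarrow> \<rho>X-lipschitz_on psd_cone (\<lambda>M. GX M p)"
    and \<rho>l: "\<And>M. M \<in> psd_cone \<Longrightarrow> \<rho>l-lipschitz_on K (Gl M)"
    and \<rho>Xl: "\<And>M. M \<in> psd_cone \<Longrightarrow> \<rho>Xl-lipschitz_on K (GX M)"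
    and \<rho>lX: "\<And>p. p \<in> K \<Longrightarrow> \<rho>lX-lipschitz_on psd_cone (\<lambda>M. Gl M p)"
    and \<eta>_pos: "0 < \<eta>"
    and \<eta>_X: "4 * \<eta>\<^sup>2 * ((\<beta> + \<rho>X)\<^sup>2 + (map_norm A)\<^sup>2 + \<rho>lX\<^sup>2) \<le> 1"
    and \<eta>_dual: "4 * \<eta>\<^sup>2 * (\<rho>l\<^sup>2 + 2 * max ((map_norm A)\<^sup>2) (\<rho>Xl\<^sup>2)) \<le> 1"
begin

abbreviation "LX \<equiv> grad_X gradf GX A"
abbreviation "Ly \<equiv> grad_y A b"
abbreviation "Ll \<equiv> grad_l Gl"
abbreviation "L \<equiv> lagrangian f G A b"

definition feas :: "((real^'n^'n) \<times> (real^'m) \<times> 'e) set" where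
  "feas = psd_cone \<times> UNIV \<times> K"

text \<open>The signs of the dual components are reversed because the method ascends in them; this
  makes the operator monotone.\<close>

definition oper :: "(real^'n^'n) \<times> (real^'m) \<times> 'e \<Rightarrow> (real^'n^'n) \<times> (real^'m) \<times> 'e" where
  "oper = (\<lambda>(X, y, p). (\<eta> *\<^sub>R LX X y p, - (\<eta> *\<^sub>R Ly X y p), - (\<eta> *\<^sub>R Ll X y p)))"

lemma LX_sym: "X \<in> sym_mats \<Longrightarrow> p \<in> K \<Longrightarrow> LX X y p \<in> sym_mats"
  unfolding grad_X_def adj_map_def
  using f_grad G_grad A_sym
  by (intro subspace_add subspace_diff subspace_sum subspace_scale subspace_sym_mats)
    (auto simp: is_gradient_sym_def are_partial_gradients_def)

lemma L_ge_X:
  assumes "X \<in> sym_mats" "X' \<in> sym_mats" "p \<in> K"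
  shows "L X y p + LX X y p \<bullet> (X' - X) \<le> L X' y p"
proof -
  have "f X + gradf X \<bullet> (X' - X) \<le> f X'"
    using assms f_grad by (intro convex_on_gradient_le[OF f_convex]) (auto simp: is_gradient_sym_def)
  moreover have "G X p + GX X p \<bullet> (X' - X) \<le> G X' p"
    using assms by (intro convex_on_gradient_le[OF G_convex] partial_gradient_X[OF G_grad]) auto
  moreover have "adj_map A y \<bullet> (X' - X) = y \<bullet> lin_map A X' - y \<bullet> lin_map A X"
    by (simp add: inner_lin_map inner_diff_right)
  ultimately show ?thesis
    by (simp add: lagrangian_def grad_X_def inner_add_left inner_diff_left inner_diff_right)
qed

text \<open>The Lagrangian is affine in \<open>y\<close>, so the inequality comes from the concavity
  of \<open>G X\<close> alone.\<close>

lemma L_le_dual: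
  assumes "X \<in> psd_cone" "p \<in> K" "p' \<in> K"
  shows "L X y' p' \<le> L X y p + Ly X y p \<bullet> (y' - y) + Ll X y p \<bullet> (p' - p)"
proof -
  have "- G X p + - (Gl X p \<bullet> (p' - p)) \<le> - G X p'"
    using assms G_concave[OF assms(1)] psd_coneD(1)[OF assms(1)]
    by (intro convex_on_gradient_le[where S = K and \<phi> = "\<lambda>p. - G X p"] has_derivative_minus
        partial_gradient_l[OF G_grad]) (auto simp: concave_on_def)
  then show ?thesis
    by (simp add: lagrangian_def grad_y_def grad_l_def inner_diff_left inner_diff_right inner_commute)
qed

lemma oper_gap:
  assumes "(X, y, p) \<in> feas" "(X', y', p') \<in> feas"
  shows "\<eta> * (L X y' p' - L X' y p) \<le> oper (X, y, p) \<bullet> ((X, y, p) - (X', y', p'))"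
proof -
  have "L X y' p' - L X' y p \<le> LX X y p \<bullet> (X - X') - Ly X y p \<bullet> (y - y') - Ll X y p \<bullet> (p - p')"
    using L_ge_X[OF psd_coneD(1) psd_coneD(1), of X X' p y] L_le_dual[of X p p' y' y] assms
    by (simp add: feas_def inner_diff_right)
  then have "\<eta> * (L X y' p' - L X' y p) \<le>
      \<eta> * (LX X y p \<bullet> (X - X') - Ly X y p \<bullet> (y - y') - Ll X y p \<bullet> (p - p'))"
    using \<eta>_pos by (intro mult_left_mono) auto
  then show ?thesis
    by (simp add: oper_def inner_diff_right algebra_simps)
qed

text \<open>The arguments of \<open>GX\<close> are changed one at a time, through
  \<open>(X', p)\<close>, because each Lipschitz constant concerns a single argument.\<close>

lemma norm_LX_diff:
  assumes "(X, y, p) \<in> feas" "(X', y', p') \<in> feas"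
  shows "norm (LX X y p - LX X' y' p') \<le>
     (\<beta> + \<rho>X) * norm (X - X') + (map_norm A * norm (y - y') + \<rho>Xl * norm (p - p'))"
proof -
  have mem: "X \<in> psd_cone" "X' \<in> psd_cone" "p \<in> K" "p' \<in> K"
    using assms by (auto simp: feas_def)
  have "norm (gradf X - gradf X') \<le> \<beta> * norm (X - X')"
    using lipschitz_onD[OF f_smooth, of X X'] mem psd_coneD(1) by (auto simp: dist_norm)
  moreover have "norm (GX X p - GX X' p) \<le> \<rho>X * norm (X - X')"
    using lipschitz_onD[OF \<rho>X, of p X X'] mem by (auto simp: dist_norm)
  moreover have "norm (GX X' p - GX X' p') \<le> \<rho>Xl * norm (p - p')"
    using lipschitz_onD[OF \<rho>Xl, of X' p p'] mem by (auto simp: dist_norm)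
  moreover have "norm (adj_map A y - adj_map A y') \<le> map_norm A * norm (y - y')"
    unfolding adj_map_diff by (intro norm_adj_map_le A_sym)
  moreover have "LX X y p - LX X' y' p' = (gradf X - gradf X') - (adj_map A y - adj_map A y') +
      ((GX X p - GX X' p) + (GX X' p - GX X' p'))"
    by (simp add: grad_X_def)
  then have "norm (LX X y p - LX X' y' p') \<le> norm (gradf X - gradf X') +
      norm (adj_map A y - adj_map A y') + (norm (GX X p - GX X' p) + norm (GX X' p - GX X' p'))"
    by (simp only: norm_triangle_le add_mono norm_triangle_ineq4 norm_triangle_ineq)
  ultimately show ?thesis
    by (simp add: algebra_simps)
qed

text \<open>Cross terms are removed by
  \<open>(s + t)\<^sup>2 \<le> 2 * s\<^sup>2 + 2 * t\<^sup>2\<close>. The coefficients of the primal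
  and of the dual squared distance are then those of \<open>\<eta>_X\<close> and
  \<open>\<eta>_dual\<close>.\<close>

lemma norm_oper_diff:
  assumes "v \<in> feas" "v' \<in> feas"
  shows "2 * (norm (oper v - oper v'))\<^sup>2 \<le> (norm (v - v'))\<^sup>2"
proof -
  obtain X y p X' y' p' where v: "v = (X, y, p)" "v' = (X', y', p')"
    by (cases v; cases v')
  have mem: "X \<in> psd_cone" "X' \<in> psd_cone" "p \<in> K" "p' \<in> K"
    using assms by (auto simp: feas_def v)
  define a where "a = norm (X - X')"
  define c where "c = norm (y - y')"
  define d where "d = norm (p - p')"
  define m where "m = max ((map_norm A)\<^sup>2) (\<rho>Xl\<^sup>2)"
  have sq: "(s + t)\<^sup>2 \<le> 2 * s\<^sup>2 + 2 * t\<^sup>2" for s t :: real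
    using zero_le_power2[of "s - t"] by (simp add: power2_eq_square algebra_simps)
  have m: "(map_norm A)\<^sup>2 * c\<^sup>2 \<le> m * c\<^sup>2" "\<rho>Xl\<^sup>2 * d\<^sup>2 \<le> m * d\<^sup>2"
    by (auto simp: m_def intro!: mult_right_mono)
  have "(norm (LX X y p - LX X' y' p'))\<^sup>2 \<le> ((\<beta> + \<rho>X) * a + (map_norm A * c + \<rho>Xl * d))\<^sup>2"
    using norm_LX_diff[of X y p X' y' p'] assms by (intro power_mono) (auto simp: a_def c_def d_def v)
  also have "\<dots> \<le> 2 * ((\<beta> + \<rho>X) * a)\<^sup>2 + 2 * (2 * (map_norm A * c)\<^sup>2 + 2 * (\<rho>Xl * d)\<^sup>2)"
    using sq[of "(\<beta> + \<rho>X) * a" "map_norm A * c + \<rho>Xl * d"] sq[of "map_norm A * c" "\<rho>Xl * d"]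
    by argo
  also have "\<dots> \<le> 2 * (\<beta> + \<rho>X)\<^sup>2 * a\<^sup>2 + 4 * m * (c\<^sup>2 + d\<^sup>2)"
    using m by (simp add: power_mult_distrib distrib_left)
  finally have 1: "(norm (LX X y p - LX X' y' p'))\<^sup>2 \<le> 2 * (\<beta> + \<rho>X)\<^sup>2 * a\<^sup>2 + 4 * m * (c\<^sup>2 + d\<^sup>2)" .
  have "norm (Ly X y p - Ly X' y' p') = norm (lin_map A (X - X'))"
    by (simp add: grad_y_def norm_minus_commute flip: lin_map_diff)
  also have "\<dots> \<le> map_norm A * a"
    unfolding a_def using mem psd_coneD(1) subspace_sym_mats
    by (intro norm_lin_map_le subspace_diff) auto
  finally have 2: "(norm (Ly X y p - Ly X' y' p'))\<^sup>2 \<le> (map_norm A)\<^sup>2 * a\<^sup>2"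
    by (metis norm_ge_zero power_mono power_mult_distrib)
  have "norm (Gl X p - Gl X' p) \<le> \<rho>lX * a"
    using lipschitz_onD[OF \<rho>lX, of p X X'] mem by (auto simp: dist_norm a_def)
  moreover have "norm (Gl X' p - Gl X' p') \<le> \<rho>l * d"
    using lipschitz_onD[OF \<rho>l, of X' p p'] mem by (auto simp: dist_norm d_def)
  ultimately have "norm (Ll X y p - Ll X' y' p') \<le> \<rho>lX * a + \<rho>l * d"
    using norm_triangle_ineq[of "Gl X p - Gl X' p" "Gl X' p - Gl X' p'"] by (simp add: grad_l_def)
  then have "(norm (Ll X y p - Ll X' y' p'))\<^sup>2 \<le> (\<rho>lX * a + \<rho>l * d)\<^sup>2"
    by (intro power_mono) auto
  also have "\<dots> \<le> 2 * \<rho>lX\<^sup>2 * a\<^sup>2 + 2 * \<rho>l\<^sup>2 * d\<^sup>2"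
    using sq[of "\<rho>lX * a" "\<rho>l * d"] by (simp add: power_mult_distrib)
  finally have 3: "(norm (Ll X y p - Ll X' y' p'))\<^sup>2 \<le> 2 * \<rho>lX\<^sup>2 * a\<^sup>2 + 2 * \<rho>l\<^sup>2 * d\<^sup>2" .
  have "oper v - oper v' = \<eta> *\<^sub>R (LX X y p - LX X' y' p',
      - (Ly X y p - Ly X' y' p'), - (Ll X y p - Ll X' y' p'))"
    by (simp add: oper_def v algebra_simps)
  then have "(norm (oper v - oper v'))\<^sup>2 = \<eta>\<^sup>2 * ((norm (LX X y p - LX X' y' p'))\<^sup>2 +
      (norm (Ly X y p - Ly X' y' p'))\<^sup>2 + (norm (Ll X y p - Ll X' y' p'))\<^sup>2)"
    by (simp add: power_mult_distrib norm_triple norm_minus_commute distrib_left)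
  \<comment> \<open>The \<open>y\<close> block is doubled and \<open>c\<^sup>2\<close> is added to
    the last term to reach the exact form of the step-size conditions.\<close>
  also have "\<dots> \<le> \<eta>\<^sup>2 * ((2 * (\<beta> + \<rho>X)\<^sup>2 * a\<^sup>2 + 4 * m * (c\<^sup>2 + d\<^sup>2)) +
      2 * (map_norm A)\<^sup>2 * a\<^sup>2 + (2 * \<rho>lX\<^sup>2 * a\<^sup>2 + 2 * \<rho>l\<^sup>2 * (c\<^sup>2 + d\<^sup>2)))"
  proof (intro mult_left_mono add_mono 1)
    show "(norm (Ly X y p - Ly X' y' p'))\<^sup>2 \<le> 2 * (map_norm A)\<^sup>2 * a\<^sup>2"
      using 2 zero_le_power2[of "map_norm A * a"] unfolding power_mult_distrib by linarith
    show "(norm (Ll X y p - Ll X' y' p'))\<^sup>2 \<le> 2 * \<rho>lX\<^sup>2 * a\<^sup>2 + 2 * \<rho>l\<^sup>2 * (c\<^sup>2 + d\<^sup>2)"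
      using 3 mult_left_mono[of "d\<^sup>2" "c\<^sup>2 + d\<^sup>2" "2 * \<rho>l\<^sup>2"] by simp
  qed simp
  finally have "2 * (norm (oper v - oper v'))\<^sup>2 \<le>
      (4 * \<eta>\<^sup>2 * ((\<beta> + \<rho>X)\<^sup>2 + (map_norm A)\<^sup>2 + \<rho>lX\<^sup>2)) * a\<^sup>2 +
      (4 * \<eta>\<^sup>2 * (\<rho>l\<^sup>2 + 2 * m)) * (c\<^sup>2 + d\<^sup>2)"
    by (simp add: algebra_simps)
  also have "\<dots> \<le> 1 * a\<^sup>2 + 1 * (c\<^sup>2 + d\<^sup>2)"
    using \<eta>_X \<eta>_dual unfolding m_def by (intro add_mono mult_right_mono) auto
  also have "\<dots> = (norm (v - v'))\<^sup>2"
    by (simp add: v norm_triple a_def c_def d_def)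
  finally show ?thesis .
qed

text \<open>For monotonicity, \<open>oper_gap\<close> is added to itself with the two points
  exchanged; the left-hand sides cancel.\<close>

sublocale monotone_lipschitz feas oper
proof
  fix v v' assume v: "v \<in> feas" "v' \<in> feas"
  obtain X y p X' y' p' where eq: "v = (X, y, p)" "v' = (X', y', p')"
    by (cases v; cases v')
  have "\<eta> * (L X y' p' - L X' y p) \<le> oper v \<bullet> (v - v')"
      "\<eta> * (L X' y p - L X y' p') \<le> oper v' \<bullet> (v' - v)"
    unfolding eq by (rule oper_gap[OF v[unfolded eq]], rule oper_gap[OF v(2,1)[unfolded eq]])
  then show "0 \<le> (oper v - oper v') \<bullet> (v - v')"
    unfolding inner_diff_left inner_diff_right right_diff_distrib by linarith
  show "2 * (norm (oper v - oper v'))\<^sup>2 \<le> (norm (v - v'))\<^sup>2"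
    using v by (rule norm_oper_diff)
qed

end

section \<open>Convergence rates\<close>

lemma diameter_ge_norm:
  assumes "compact K" "x \<in> K" "y \<in> K"
  shows "norm (x - y) \<le> diameter K"
  using diameter_bounded_bound[OF compact_imp_bounded[OF assms(1)] assms(2,3)] by (simp add: dist_norm)

text \<open>The run uses exact projections. All rates are proved for it, and truncated runs are
  later shown to coincide with it.\<close>

locale extragradient_saddle = saddle_problem f gradf G GX Gl K A b \<beta> \<rho>X \<rho>l \<rho>Xl \<rho>lX \<eta>
  for f :: "real^'n^'n \<Rightarrow> real" and gradf
    and G :: "real^'n^'n \<Rightarrow> 'e::euclidean_space \<Rightarrow> real" and GX Gl K
    and A :: "'m::finite \<Rightarrow> real^'n^'n" and b \<beta> \<rho>X \<rho>l \<rho>Xl \<rho>lX \<eta> +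
  fixes g :: "real^'n^'n \<Rightarrow> real"
    and Xs :: "real^'n^'n" and ys :: "real^'m" and ls :: 'e
    and X Z :: "nat \<Rightarrow> real^'n^'n" and y w :: "nat \<Rightarrow> real^'m" and l \<mu> :: "nat \<Rightarrow> 'e"
  assumes g_max: "\<And>M. M \<in> sym_mats \<Longrightarrow> (\<exists>p\<in>K. g M = G M p) \<and> (\<forall>p\<in>K. G M p \<le> g M)"
    and Xs_feasible: "Xs \<in> feasible A b"
    and dual: "saddle_point (lagrangian f G A b) K Xs ys ls"
    and start: "X 1 \<in> psd_cone" "l 1 \<in> K"
    and run: "extragradient psd_proj LX Ly Ll K \<eta> X y l Z w \<mu>"
begin

section \<open>The run as extragradient steps of the saddle operator\<close>

definition sol :: "(real^'n^'n) \<times> (real^'m) \<times> 'e" where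
  "sol = (Xs, ys, ls)"

definition iter :: "nat \<Rightarrow> (real^'n^'n) \<times> (real^'m) \<times> 'e" where
  "iter t = (X t, y t, l t)"

definition half :: "nat \<Rightarrow> (real^'n^'n) \<times> (real^'m) \<times> 'e" where
  "half t = (Z t, w t, \<mu> t)"

lemma sol_feas: "sol \<in> feas"
  using dual by (auto simp: sol_def feas_def saddle_point_def)

lemma saddle_le:
  assumes "(M, u, p) \<in> feas"
  shows "L Xs u p \<le> L Xs ys ls" "L Xs ys ls \<le> L M ys ls"
  using assms dual by (auto simp: feas_def saddle_point_def)

text \<open>This supplies the Minty inequality for the abstract estimates: the gap measured against
  a saddle point is nonnegative.\<close>

lemma oper_sol:
  assumes "v \<in> feas"
  shows "0 \<le> oper v \<bullet> (v - sol)"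
proof -
  obtain M u p where v: "v = (M, u, p)"
    by (cases v)
  have "0 \<le> \<eta> * (L M ys ls - L Xs u p)"
    using saddle_le[of M u p] assms \<eta>_pos by (intro mult_nonneg_nonneg) (auto simp: v)
  also have "\<dots> \<le> oper v \<bullet> (v - sol)"
    using oper_gap[of M u p Xs ys ls] assms sol_feas unfolding v sol_def by blast
  finally show ?thesis .
qed

lemma K_nonempty: "K \<noteq> {}"
  using start by auto

lemma psd_proj_dot:
  assumes "psd_proj M Y"
  shows "Y \<in> psd_cone" "V \<in> psd_cone \<Longrightarrow> (M - Y) \<bullet> (V - Y) \<le> 0"
  using assms closest_point_in_set[OF closed_psd_cone] zero_in_psd_cone
    closest_point_dot[OF convex_psd_cone closed_psd_cone]
  by (auto simp: psd_proj_def)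

lemma closest_point_K_dot:
  "closest_point K p \<in> K" "q \<in> K \<Longrightarrow> (p - closest_point K p) \<bullet> (q - closest_point K p) \<le> 0"
  using closest_point_in_set[OF compact_imp_closed[OF K(1)] K_nonempty]
    closest_point_dot[OF K(2) compact_imp_closed[OF K(1)]] by auto

lemma run_step:
  assumes "t \<ge> 1"
  shows "psd_proj (X t - \<eta> *\<^sub>R LX (X t) (y t) (l t)) (Z (Suc t))"
    "w (Suc t) = y t + \<eta> *\<^sub>R Ly (X t) (y t) (l t)"
    "\<mu> (Suc t) = closest_point K (l t + \<eta> *\<^sub>R Ll (X t) (y t) (l t))"
    "psd_proj (X t - \<eta> *\<^sub>R LX (Z (Suc t)) (w (Suc t)) (\<mu> (Suc t))) (X (Suc t))"
    "y (Suc t) = y t + \<eta> *\<^sub>R Ly (Z (Suc t)) (w (Suc t)) (\<mu> (Suc t))"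
    "l (Suc t) = closest_point K (l t + \<eta> *\<^sub>R Ll (Z (Suc t)) (w (Suc t)) (\<mu> (Suc t)))"
  using run assms by (auto simp: extragradient_def)

text \<open>The projection residual vanishes in the unconstrained \<open>y\<close> component, so the
  inequality is the sum of those for the cone and for \<open>K\<close>.\<close>

lemma proj_step_dot:
  assumes "psd_proj (M - \<eta> *\<^sub>R LX M' u' p') Y" "(V, u'', q) \<in> feas"
  shows "((M, u, p) - oper (M', u', p') -
      (Y, u + \<eta> *\<^sub>R Ly M' u' p', closest_point K (p + \<eta> *\<^sub>R Ll M' u' p'))) \<bullet>
     ((V, u'', q) - (Y, u + \<eta> *\<^sub>R Ly M' u' p', closest_point K (p + \<eta> *\<^sub>R Ll M' u' p'))) \<le> 0"
  using psd_proj_dot(2)[OF assms(1), of V] assms(2)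
    closest_point_K_dot(2)[of q "p + \<eta> *\<^sub>R Ll M' u' p'"]
  by (simp add: oper_def feas_def)

lemma iter_feas: "t \<ge> 1 \<Longrightarrow> iter t \<in> feas"
proof (induction t rule: nat_induct_at_least)
  case base
  then show ?case
    using start by (simp add: iter_def feas_def)
next
  case (Suc t)
  then show ?case
    using run_step[of t] psd_proj_dot(1) closest_point_K_dot(1) by (auto simp: iter_def feas_def)
qed

lemma half_feas: "t \<ge> 1 \<Longrightarrow> half (Suc t) \<in> feas"
  using run_step[of t] psd_proj_dot(1) closest_point_K_dot(1) by (auto simp: half_def feas_def)

lemma run_eg_step:
  assumes "t \<ge> 1"
  shows "eg_step (iter t) (half (Suc t)) (iter (Suc t))"
  unfolding eg_step_def
proof (intro conjI ballI)
  fix v assume v: "v \<in> feas"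
  obtain V u q where V: "v = (V, u, q)"
    by (cases v)
  show "(iter t - oper (iter t) - half (Suc t)) \<bullet> (v - half (Suc t)) \<le> 0"
    using proj_step_dot[OF run_step(1)[OF assms], of V u q "y t" "l t"] v
    unfolding V iter_def half_def run_step(2,3)[OF assms] by blast
  show "(iter t - oper (half (Suc t)) - iter (Suc t)) \<bullet> (v - iter (Suc t)) \<le> 0"
    using proj_step_dot[OF run_step(4)[OF assms], of V u q "y t" "l t"] v
    unfolding V iter_def half_def run_step(5,6)[OF assms] by blast
qed (use assms iter_feas half_feas in auto)

lemma dist_iter_le: "t \<ge> 1 \<Longrightarrow> norm (iter t - sol) \<le> norm (iter 1 - sol)"
proof (induction t rule: nat_induct_at_least)
  case (Suc t)
  then show ?case
    using dist_half_step_le(2)[OF run_eg_step sol_feas oper_sol] order_trans by blast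
qed simp

lemma dist_half_le: "t \<ge> 1 \<Longrightarrow> norm (half (Suc t) - sol) \<le> 2 * norm (iter 1 - sol)"
  using dist_half_step_le(1)[OF run_eg_step sol_feas oper_sol] dist_iter_le by fastforce

section \<open>From the Lagrangian gap to objective error and infeasibility\<close>

lemma gap_step:
  assumes t: "t \<ge> 1" and v: "(M, u, p) \<in> feas"
  shows "2 * \<eta> * (L (Z (Suc t)) u p - L M (w (Suc t)) (\<mu> (Suc t))) \<le>
     (norm (iter t - (M, u, p)))\<^sup>2 - (norm (iter (Suc t) - (M, u, p)))\<^sup>2"
proof -
  have "\<eta> * (L (Z (Suc t)) u p - L M (w (Suc t)) (\<mu> (Suc t))) \<le>
      oper (half (Suc t)) \<bullet> (half (Suc t) - (M, u, p))"
    using oper_gap[of "Z (Suc t)" "w (Suc t)" "\<mu> (Suc t)" M u p] half_feas[OF t] v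
    unfolding half_def by blast
  moreover have "0 \<le> decrease (iter t) (half (Suc t)) (iter (Suc t))"
    using decrease_ge[OF run_eg_step[OF t]] zero_le_power2 order_trans zero_le_mult_iff
    by (smt (verit))
  ultimately show ?thesis
    using eg_step_gap[OF run_eg_step[OF t] v] by simp
qed

text \<open>Feasibility removes the multiplier term, and maximality of the dual solution turns
  \<open>G Xs ls\<close> into the maximum \<open>g Xs\<close>.\<close>

lemma L_sol: "L Xs ys ls = f Xs + g Xs"
proof -
  have Xs: "Xs \<in> psd_cone" "lin_map A Xs = b"
    using Xs_feasible by (auto simp: feasible_def)
  have L: "L Xs u p = f Xs + G Xs p" for u p
    by (simp add: lagrangian_def Xs)
  have "G Xs ls = g Xs"
    using dual g_max[OF psd_coneD(1)[OF Xs(1)]] unfolding saddle_point_def L by force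
  then show ?thesis
    by (simp add: L)
qed

text \<open>The test points with \<open>\<parallel>u\<parallel> \<le> 2 \<parallel>y\<^sup>*\<parallel>\<close> detect both the objective error (at \<open>u = 0\<close>) and the
  infeasibility (at a multiple of \<open>b - A M\<close>), because the saddle point bounds the objective from below by
  \<open>- \<parallel>y\<^sup>*\<parallel> \<parallel>A M - b\<parallel>\<close>.\<close>

lemma gap_imp_accuracy:
  assumes M: "M \<in> psd_cone"
    and gap: "\<And>u p. norm u \<le> 2 * norm ys \<Longrightarrow> p \<in> K \<Longrightarrow> L M u p - L Xs ys ls \<le> \<epsilon>"
  shows "f M + g M - f Xs - g Xs \<le> \<epsilon>"
    and "ys \<noteq> 0 \<Longrightarrow> norm (lin_map A M - b) \<le> \<epsilon> / norm ys"
proof -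
  obtain p where p: "p \<in> K" "g M = G M p"
    using g_max psd_coneD(1)[OF M] by blast
  show "f M + g M - f Xs - g Xs \<le> \<epsilon>"
    using gap[of 0 p] p by (simp add: L_sol) (simp add: lagrangian_def)
  define d where "d = b - lin_map A M"
  \<comment> \<open>The product \<open>u \<bullet> d\<close> carries the factor 2, of which the
    lower bound from the saddle point consumes one. For \<open>d = 0\<close> this gives
    \<open>u = 0\<close>, and both formulas below still hold.\<close>
  define u where "u = (2 * norm ys / norm d) *\<^sub>R d"
  have "norm u \<le> 2 * norm ys"
    by (simp add: u_def)
  then have "f M + G M p + u \<bullet> d - L Xs ys ls \<le> \<epsilon>"
    using gap[of u p] p by (simp add: lagrangian_def d_def)
  moreover have "u \<bullet> d = 2 * norm ys * norm d"
    by (simp add: u_def flip: power2_norm_eq_inner) (simp add: power2_eq_square)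
  moreover have "L Xs ys ls \<le> f M + G M p + norm ys * norm d"
  proof -
    have "L Xs ys ls \<le> L M ys ls"
      using saddle_le(2)[of M ys ls] M sol_feas by (simp add: feas_def sol_def)
    also have "\<dots> \<le> f M + G M p + ys \<bullet> d"
      using g_max[OF psd_coneD(1)[OF M]] p dual by (simp add: lagrangian_def d_def saddle_point_def)
    also have "\<dots> \<le> f M + G M p + norm ys * norm d"
      by (simp add: norm_cauchy_schwarz)
    finally show ?thesis .
  qed
  ultimately have "norm ys * norm d \<le> \<epsilon>"
    by linarith
  then show "ys \<noteq> 0 \<Longrightarrow> norm (lin_map A M - b) \<le> \<epsilon> / norm ys"
    by (simp add: d_def norm_minus_commute field_simps)
qed

text \<open>At a fixed test point \<open>gap_step\<close> telescopes, the value at \<open>Xs\<close>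
  being at most that of the saddle point. Jensen's inequality passes to the average, as the
  Lagrangian is convex in its first argument.\<close>

lemma ergodic_gap:
  assumes T: "T \<ge> 1" and p: "p \<in> K"
  defines "Xbar \<equiv> (1 / real T) *\<^sub>R (\<Sum>t=1..T. Z (t + 1))"
  shows "L Xbar u p - L Xs ys ls \<le> (norm (iter 1 - (Xs, u, p)))\<^sup>2 / (2 * \<eta> * real T)"
proof -
  have v: "(Xs, u, p) \<in> feas"
    using p sol_feas by (auto simp: feas_def sol_def)
  have Z: "Z (t + 1) \<in> psd_cone" if "t \<in> {1..T}" for t
    using half_feas[of t] that by (auto simp: half_def feas_def)
  have "2 * \<eta> * (\<Sum>t=1..T. L (Z (t + 1)) u p - L Xs ys ls) \<le>
      (\<Sum>t=1..T. (norm (iter t - (Xs, u, p)))\<^sup>2 - (norm (iter (Suc t) - (Xs, u, p)))\<^sup>2)"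
    unfolding sum_distrib_left
  proof (rule sum_mono)
    fix t assume "t \<in> {1..T}"
    then have "2 * \<eta> * (L (Z (Suc t)) u p - L Xs ys ls) \<le>
        2 * \<eta> * (L (Z (Suc t)) u p - L Xs (w (Suc t)) (\<mu> (Suc t)))"
      using saddle_le(1)[of "Z (Suc t)" "w (Suc t)" "\<mu> (Suc t)"] half_feas[of t] \<eta>_pos
      by (intro mult_left_mono) (auto simp: half_def)
    then show "2 * \<eta> * (L (Z (t + 1)) u p - L Xs ys ls) \<le>
        (norm (iter t - (Xs, u, p)))\<^sup>2 - (norm (iter (Suc t) - (Xs, u, p)))\<^sup>2"
      using gap_step[OF _ v, of t] \<open>t \<in> {1..T}\<close> by simp
  qed
  also have "\<dots> = (norm (iter 1 - (Xs, u, p)))\<^sup>2 - (norm (iter (Suc T) - (Xs, u, p)))\<^sup>2"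
    by (induction T) simp_all
  finally have sum: "2 * \<eta> * (\<Sum>t=1..T. L (Z (t + 1)) u p - L Xs ys ls) \<le> (norm (iter 1 - (Xs, u, p)))\<^sup>2"
    using zero_le_power2[of "norm (iter (Suc T) - (Xs, u, p))"] by linarith
  have wt: "(\<Sum>t=1..T. 1 / real T) = 1" "finite {1..T}" "{1..T} \<noteq> {}"
    using T by auto
  have "f Xbar \<le> (\<Sum>t=1..T. 1 / real T * f (Z (t + 1)))"
    unfolding Xbar_def scaleR_sum_right
    using wt psd_coneD(1)[OF Z] by (intro convex_on_sum[OF _ _ f_convex]) auto
  moreover have "G Xbar p \<le> (\<Sum>t=1..T. 1 / real T * G (Z (t + 1)) p)"
    unfolding Xbar_def scaleR_sum_right
    using wt psd_coneD(1)[OF Z] p by (intro convex_on_sum[OF _ _ G_convex]) auto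
  moreover have "u \<bullet> (b - lin_map A Xbar) = (\<Sum>t=1..T. 1 / real T * (u \<bullet> (b - lin_map A (Z (t + 1)))))"
    using T by (simp add: Xbar_def inner_diff_right inner_lin_map inner_sum_right right_diff_distrib
        sum_subtractf sum_divide_distrib)
  ultimately have "L Xbar u p \<le> (\<Sum>t=1..T. 1 / real T * L (Z (t + 1)) u p)"
    by (simp add: lagrangian_def distrib_left sum.distrib add_divide_distrib)
  then have "L Xbar u p - L Xs ys ls \<le> (\<Sum>t=1..T. L (Z (t + 1)) u p - L Xs ys ls) / real T"
    using T by (simp add: sum_subtractf diff_divide_distrib sum_divide_distrib)
  also have "\<dots> \<le> ((norm (iter 1 - (Xs, u, p)))\<^sup>2 / (2 * \<eta>)) / real T"
    using sum \<eta>_pos by (intro divide_right_mono) (auto simp: field_simps)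
  finally show ?thesis
    by simp
qed

lemma last_iterate_gap:
  assumes T: "T \<ge> 1" and p: "p \<in> K" and u: "norm u \<le> 2 * norm ys"
    and R: "2 * norm (iter 1 - sol) \<le> R" "3 * sqrt 2 * norm ys \<le> R" "sqrt 2 * diameter K \<le> R"
  shows "L (Z (Suc T)) u p - L Xs ys ls \<le> 3 * sqrt 2 * R * norm (iter 1 - sol) / (\<eta> * sqrt (real T))"
proof -
  let ?d = "norm (iter 1 - sol)"
  \<comment> \<open>By convexity of the norm the midpoint is as close to \<open>sol\<close> as the
    start, without the factor 2 of the half step.\<close>
  define mid where "mid = (1/2) *\<^sub>R iter T + (1/2) *\<^sub>R iter (Suc T)"
  have v: "(Xs, u, p) \<in> feas"
    using p sol_feas by (auto simp: feas_def sol_def)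
  have mid: "norm (mid - sol) \<le> ?d"
  proof -
    have "mid - sol = (1/2) *\<^sub>R (iter T - sol) + (1/2) *\<^sub>R (iter (Suc T) - sol)"
      by (simp add: mid_def algebra_simps flip: scaleR_add_left)
    also have "norm \<dots> \<le> (1/2) * norm (iter T - sol) + (1/2) * norm (iter (Suc T) - sol)"
      by (rule norm_triangle_le) simp
    also have "\<dots> \<le> ?d"
      using dist_iter_le[of T] dist_iter_le[of "Suc T"] T by simp
    finally show ?thesis .
  qed
  have R0: "0 \<le> R"
    using R(1) norm_ge_zero[of "iter 1 - sol"] by linarith
  obtain M y' l' where m: "mid = (M, y', l')"
    by (cases mid)
  have "l' = (1/2) *\<^sub>R l T + (1/2) *\<^sub>R l (Suc T)"
    using m by (simp add: mid_def iter_def)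
  moreover have "l T \<in> K" "l (Suc T) \<in> K"
    using iter_feas[of T] iter_feas[of "Suc T"] T by (auto simp: iter_def feas_def)
  ultimately have "l' \<in> K"
    using convexD[OF K(2), of "l T" "l (Suc T)" "1/2" "1/2"] by simp
  then have "norm (l' - p) \<le> diameter K"
    by (intro diameter_ge_norm K p)
  moreover have "diameter K \<le> R / sqrt 2"
    using R(3) by (simp add: field_simps)
  ultimately have "(norm (l' - p))\<^sup>2 \<le> (R / sqrt 2)\<^sup>2"
    by (intro power_mono) auto
  then have dual_part: "(norm (l' - p))\<^sup>2 \<le> R\<^sup>2 / 2"
    by (simp add: power_divide)
  \<comment> \<open>Primal and \<open>y\<close> parts are estimated together via
    \<open>(Xs, ys)\<close>: the first leg is at most \<open>R / 2\<close>, and the second, of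
    length at most \<open>3 * norm ys\<close>, is at most \<open>R / sqrt 2\<close>.\<close>
  have "norm (M - Xs, y' - u) \<le> norm (M - Xs, y' - ys) + norm (0 :: real^'n^'n, ys - u)"
    using norm_triangle_ineq[of "(M - Xs, y' - ys)" "(0 :: real^'n^'n, ys - u)"] by simp
  moreover have "norm (M - Xs, y' - ys) \<le> norm (mid - sol)"
    by (simp add: m sol_def norm_prod_def)
  moreover have "norm (0 :: real^'n^'n, ys - u) \<le> 3 * norm ys"
    using norm_triangle_ineq4[of ys u] u by (simp add: norm_Pair)
  moreover have "3 * norm ys \<le> R / sqrt 2"
    using R(2) by (simp add: field_simps)
  ultimately have "norm (M - Xs, y' - u) \<le> R / 2 + R / sqrt 2"
    using mid R(1) by linarith
  then have "(norm (M - Xs, y' - u))\<^sup>2 \<le> (R / 2 + R / sqrt 2)\<^sup>2"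
    by (intro power_mono) auto
  also have "\<dots> = R\<^sup>2 * (1 / 2 + 1 / sqrt 2)\<^sup>2"
    by (simp add: power2_eq_square algebra_simps)
  \<comment> \<open>The square equals \<open>3 / 4 + sqrt 2 / 2\<close>. Together with
    \<open>R\<^sup>2 / 2\<close> from the part in \<open>K\<close> this makes
    \<open>2 * R\<^sup>2\<close>.\<close>
  also have "\<dots> \<le> R\<^sup>2 * (3 / 2)"
  proof (intro mult_left_mono)
    have "sqrt 2 \<le> 3 / 2"
      by (rule real_le_lsqrt[THEN order_trans[rotated]] real_le_lsqrt) (auto simp: power2_eq_square)
    then show "(1 / 2 + 1 / sqrt 2)\<^sup>2 \<le> (3 / 2 :: real)"
      by (simp add: power2_eq_square field_simps)
  qed simp
  finally have primal_part: "(norm (M - Xs, y' - u))\<^sup>2 \<le> 3 / 2 * R\<^sup>2"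
    by simp
  have "(norm (mid - (Xs, u, p)))\<^sup>2 = (norm (M - Xs, y' - u))\<^sup>2 + (norm (l' - p))\<^sup>2"
    by (simp add: m norm_triple norm_Pair)
  also have "\<dots> \<le> (sqrt 2 * R)\<^sup>2"
    using primal_part dual_part by (simp add: power_mult_distrib)
  finally have "norm (mid - (Xs, u, p)) \<le> sqrt 2 * R"
    by (rule power2_le_imp_le) (simp add: R0)
  have "(sqrt (real T) * norm (iter T - iter (Suc T)))\<^sup>2 \<le> (3 * ?d)\<^sup>2"
    using displacement_rate[where z = iter and w = half, OF run_eg_step sol_feas oper_sol T] by (simp add: power_mult_distrib)
  then have "sqrt (real T) * norm (iter T - iter (Suc T)) \<le> 3 * ?d"
    by (rule power2_le_imp_le) simp
  then have displ: "norm (iter T - iter (Suc T)) \<le> 3 * ?d / sqrt (real T)"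
    using T by (simp add: field_simps)
  have "2 * \<eta> * (L (Z (Suc T)) u p - L Xs ys ls) \<le>
      2 * \<eta> * (L (Z (Suc T)) u p - L Xs (w (Suc T)) (\<mu> (Suc T)))"
    using saddle_le(1)[of "Z (Suc T)" "w (Suc T)" "\<mu> (Suc T)"] half_feas[of T] T \<eta>_pos
    by (intro mult_left_mono) (auto simp: half_def)
  also have "\<dots> \<le> (norm (iter T - (Xs, u, p)))\<^sup>2 - (norm (iter (Suc T) - (Xs, u, p)))\<^sup>2"
    by (rule gap_step[OF T v])
  also have "\<dots> = 2 * ((iter T - iter (Suc T)) \<bullet> (mid - (Xs, u, p)))"
    by (simp add: mid_def power2_norm_eq_inner inner_diff_left inner_diff_right inner_add_right
        inner_commute field_simps del: inner_Pair inner_Pair_0)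
  also have "\<dots> \<le> 2 * (norm (iter T - iter (Suc T)) * norm (mid - (Xs, u, p)))"
    by (intro mult_left_mono norm_cauchy_schwarz) simp
  also have "\<dots> \<le> 2 * ((3 * ?d / sqrt (real T)) * (sqrt 2 * R))"
    using displ \<open>norm (mid - (Xs, u, p)) \<le> sqrt 2 * R\<close> by (intro mult_left_mono mult_mono) auto
  finally have "\<eta> * (L (Z (Suc T)) u p - L Xs ys ls) \<le> (3 * ?d / sqrt (real T)) * (sqrt 2 * R)"
    unfolding mult.assoc by linarith
  then show ?thesis
    using \<eta>_pos T by (simp add: field_simps)
qed

end

section \<open>Exactness of the truncated projections\<close>

context extragradient_saddle
begin

section \<open>Optimality conditions and distance to the fixed point\<close>

abbreviation "Hs \<equiv> LX Xs ys ls"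

text \<open>The variational inequality at \<open>Xs\<close> is tested at
  \<open>Xs + outer x x\<close> for semidefiniteness, and at \<open>2 *\<^sub>R Xs\<close> and
  \<open>0\<close> for complementarity.\<close>

lemma gradient_optimal: "Hs \<in> psd_cone" "Xs \<bullet> Hs = 0"
proof -
  have Xs: "Xs \<in> psd_cone" and ls: "ls \<in> K" and min: "\<And>M. M \<in> psd_cone \<Longrightarrow> L Xs ys ls \<le> L M ys ls"
    using dual by (auto simp: saddle_point_def)
  note Xs_sym = psd_coneD(1)[OF Xs]
  have f: "(f has_derivative (\<lambda>H. gradf Xs \<bullet> H)) (at Xs within sym_mats)"
    using f_grad Xs_sym by (simp add: is_gradient_sym_def)
  have A: "((\<lambda>M. ys \<bullet> (b - lin_map A M)) has_derivative (\<lambda>H. - (adj_map A ys \<bullet> H))) (at Xs within sym_mats)"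
    by (rule derivative_eq_intros bounded_linear.has_derivative[OF bounded_linear_lin_map] refl)+
      (simp add: inner_lin_map)
  have "((\<lambda>M. L M ys ls) has_derivative (\<lambda>H. Hs \<bullet> H)) (at Xs within sym_mats)"
    using has_derivative_add[OF has_derivative_add[OF f partial_gradient_X[OF G_grad Xs_sym ls]] A]
    by (simp add: lagrangian_def grad_X_def inner_add_left inner_diff_left algebra_simps)
  then have deriv: "((\<lambda>M. L M ys ls) has_derivative (\<lambda>H. Hs \<bullet> H)) (at Xs within psd_cone)"
    using psd_coneD(1) by (auto intro: has_derivative_subset)
  have opt: "0 \<le> Hs \<bullet> (V - Xs)" if "V \<in> psd_cone" for V
    using min_on_gradient_ge[OF convex_psd_cone Xs that deriv min] .
  have "0 \<le> x \<bullet> (Hs *v x)" for x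
    using opt[OF psd_cone_add[OF Xs outer_in_psd_cone[of x]]] by (simp add: inner_outer)
  then show "Hs \<in> psd_cone"
    using LX_sym[OF Xs_sym ls] by (simp add: psd_cone_def)
  have "0 \<le> Hs \<bullet> Xs"
    using opt[OF psd_cone_scale[OF Xs, of 2]] by (simp add: scaleR_2)
  moreover have "Hs \<bullet> Xs \<le> 0"
    using opt[OF zero_in_psd_cone] by simp
  ultimately show "Xs \<bullet> Hs = 0"
    by (simp add: inner_commute)
qed

text \<open>The two entries of the maximum are the cases \<open>p = 1\<close> and
  \<open>p = rt\<close> of \<open>eigenvalue_nonpos_near\<close>. If \<open>rt = 0\<close> the
  second entry is 0, and the first, which is positive, applies.\<close>

lemma eigval_nonpos_near_sol:
  fixes r :: nat
  defines "rt \<equiv> CARD('n) - rank Hs"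
  assumes r: "rt \<le> r" "r < CARD('n)" "r + 2 \<le> CARD('n) + rt" and M: "M \<in> sym_mats"
    and near: "norm (M - (Xs - \<eta> *\<^sub>R Hs)) \<le>
      \<eta> * max (eigval (CARD('n) - r) Hs) (sqrt (real rt) * eigval (CARD('n) - r + rt - 1) Hs)"
  shows "eigval (r + 1) M \<le> 0"
proof -
  obtain h u where H: "eigen_decomposition Hs h u"
    using eigen_decomposition_exists psd_coneD(1)[OF gradient_optimal(1)] by blast
  obtain l v where lv: "eigen_decomposition M l v"
    using eigen_decomposition_exists[OF M] by blast
  have rank: "rank Hs \<le> CARD('n)"
    using rank_bound[of Hs] by simp
  have Xs: "Xs \<in> psd_cone"
    using dual by (simp add: saddle_point_def)
  note crit = eigenvalue_nonpos_near[OF lv H Xs gradient_optimal \<eta>_pos r(2)]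
  have eig: "eigval (CARD('n) - r) Hs = h (CARD('n) - r)"
    "eigval (CARD('n) - r + rt - 1) Hs = h (CARD('n) - r + rt - 1)"
    using r by (auto intro!: eigval_eq[OF H])
  \<comment> \<open>Since \<open>rt \<le> r\<close>, the index \<open>n - r\<close> does not exceed
    the rank.\<close>
  have pos: "0 < h (CARD('n) - r)"
    using r rank by (intro psd_eigenvalue_pos_le_rank[OF gradient_optimal(1) H]) (auto simp: rt_def)
  have "l (r + 1) \<le> 0"
  proof (cases "sqrt (real rt) * h (CARD('n) - r + rt - 1) \<le> h (CARD('n) - r)")
    case True
    show ?thesis
    proof (rule crit[of 1 "CARD('n) - r"])
      show "norm (M - (Xs - \<eta> *\<^sub>R Hs)) \<le> \<eta> * (sqrt (real 1) * h (CARD('n) - r))"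
        using near True unfolding eig by (simp add: max_absorb1)
    qed (use r pos in auto)
  next
    case False
    then have gt: "0 < sqrt (real rt) * h (CARD('n) - r + rt - 1)"
      using pos by linarith
    then have rt: "1 \<le> rt" "0 < h (CARD('n) - r + rt - 1)"
      by (auto simp: zero_less_mult_iff Suc_le_eq)
    show ?thesis
    proof (rule crit[of rt "CARD('n) - r + rt - 1"])
      show "norm (M - (Xs - \<eta> *\<^sub>R Hs)) \<le> \<eta> * (sqrt (real rt) * h (CARD('n) - r + rt - 1))"
        using near False unfolding eig by (simp add: max_absorb2)
    qed (use r rt in auto)
  qed
  then show ?thesis
    using eigval_eq[OF lv, of "r + 1"] r by simp
qed

lemma dist_gradient_step:
  assumes v: "(M, u, p) \<in> feas" and c: "\<beta> + \<rho>X \<le> c" "map_norm A \<le> c" "\<rho>Xl \<le> c"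
  shows "norm ((V - \<eta> *\<^sub>R LX M u p) - (Xs - \<eta> *\<^sub>R Hs)) \<le>
    norm (V - Xs) + 2 * \<eta> * c * norm ((M, u, p) - sol)"
proof -
  define a where "a = norm (M - Xs)"
  define d where "d = norm (u - ys)"
  define e where "e = norm (p - ls)"
  have c0: "0 \<le> c"
    using c(2) map_norm_nonneg[of A] by linarith
  have "(a + d + e)\<^sup>2 = a\<^sup>2 + d\<^sup>2 + e\<^sup>2 + 2 * a * d + 2 * a * e + 2 * d * e"
    by (simp add: power2_eq_square algebra_simps)
  \<comment> \<open>The mixed terms give the factor 3, rounded up to 4 so that the root is the 2 in
    the denominator of the initial radius.\<close>
  also have "\<dots> \<le> 2\<^sup>2 * (a\<^sup>2 + d\<^sup>2 + e\<^sup>2)"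
    using sum_squares_bound[of a d] sum_squares_bound[of a e] sum_squares_bound[of d e]
      zero_le_power2[of a] zero_le_power2[of d] zero_le_power2[of e] unfolding power2_eq_square[of 2] by argo
  also have "a\<^sup>2 + d\<^sup>2 + e\<^sup>2 = (norm ((M, u, p) - sol))\<^sup>2"
    by (simp add: sol_def norm_triple a_def d_def e_def)
  finally have "(a + d + e)\<^sup>2 \<le> (2 * norm ((M, u, p) - sol))\<^sup>2"
    by (simp add: power_mult_distrib)
  then have sum: "a + d + e \<le> 2 * norm ((M, u, p) - sol)"
    by (rule power2_le_imp_le) simp
  have "norm (LX M u p - Hs) \<le> (\<beta> + \<rho>X) * a + (map_norm A * d + \<rho>Xl * e)"
    unfolding a_def d_def e_def by (rule norm_LX_diff[OF v sol_feas[unfolded sol_def]])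
  also have "\<dots> \<le> c * a + (c * d + c * e)"
    using c by (intro add_mono mult_right_mono) (auto simp: a_def d_def e_def)
  also have "\<dots> = c * (a + d + e)"
    by (simp add: algebra_simps)
  also have "\<dots> \<le> c * (2 * norm ((M, u, p) - sol))"
    using sum c0 by (rule mult_left_mono)
  finally have "\<eta> * norm (LX M u p - Hs) \<le> 2 * \<eta> * c * norm ((M, u, p) - sol)"
    using \<eta>_pos by simp
  moreover have eq: "(V - \<eta> *\<^sub>R LX M u p) - (Xs - \<eta> *\<^sub>R Hs) = (V - Xs) - \<eta> *\<^sub>R (LX M u p - Hs)"
    by (simp add: algebra_simps)
  have "norm ((V - \<eta> *\<^sub>R LX M u p) - (Xs - \<eta> *\<^sub>R Hs)) \<le> norm (V - Xs) + \<eta> * norm (LX M u p - Hs)"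
    using norm_triangle_ineq4[of "V - Xs" "\<eta> *\<^sub>R (LX M u p - Hs)"] \<eta>_pos unfolding eq by simp
  ultimately show ?thesis
    by linarith
qed

text \<open>With \<open>d = norm (iter 1 - sol)\<close>, the base point stays within
  \<open>d\<close> of \<open>Xs\<close> and the point where the gradient is taken within
  \<open>2 * d\<close> of \<open>sol\<close>, in both projections of a step. The distance to the
  fixed point is thus at most \<open>d + 4 * \<eta> * c * d\<close>.\<close>

lemma trunc_psd_proj_iff_iter:
  fixes r :: nat and c :: real
  defines "rt \<equiv> CARD('n) - rank Hs"
  assumes r: "rt \<le> r" "r < CARD('n)" "r + 2 \<le> CARD('n) + rt"
    and c: "\<beta> + \<rho>X \<le> c" "map_norm A \<le> c" "\<rho>Xl \<le> c"
    and init: "2 * (1 + 2 * \<eta> * c) * norm (iter 1 - sol) \<le>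
      \<eta> * max (eigval (CARD('n) - r) Hs) (sqrt (real rt) * eigval (CARD('n) - r + rt - 1) Hs)"
    and t: "t \<ge> 1" and v: "(M, u, p) \<in> {iter t, half (Suc t)}"
  shows "trunc_psd_proj r (X t - \<eta> *\<^sub>R LX M u p) Y \<longleftrightarrow> psd_proj (X t - \<eta> *\<^sub>R LX M u p) Y"
proof (rule trunc_psd_proj_iff)
  have feas: "(M, u, p) \<in> feas"
    using v iter_feas[OF t] half_feas[OF t] by (elim insertE emptyE) (simp_all only:)
  then have mem: "M \<in> sym_mats" "p \<in> K"
    using psd_coneD(1) by (auto simp: feas_def)
  have "X t \<in> sym_mats"
    using iter_feas[OF t] psd_coneD(1) by (auto simp: feas_def iter_def)
  then show sym: "X t - \<eta> *\<^sub>R LX M u p \<in> sym_mats"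
    by (intro subspace_diff subspace_scale subspace_sym_mats LX_sym mem)
  have c0: "0 \<le> c"
    using c(2) map_norm_nonneg[of A] by linarith
  have "norm (X t - Xs) \<le> norm (iter t - sol)"
    using norm_fst_le[of "X t - Xs" "(y t, l t) - (ys, ls)"] by (simp add: iter_def sol_def)
  then have "norm (X t - Xs) \<le> norm (iter 1 - sol)"
    using dist_iter_le[OF t] by linarith
  moreover have "norm (iter t - sol) \<le> 2 * norm (iter 1 - sol)"
    using dist_iter_le[OF t] norm_ge_zero[of "iter 1 - sol"] by linarith
  then have "\<forall>q\<in>{iter t, half (Suc t)}. norm (q - sol) \<le> 2 * norm (iter 1 - sol)"
    using dist_half_le[OF t] by blast
  then have "norm ((M, u, p) - sol) \<le> 2 * norm (iter 1 - sol)"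
    using v by (rule bspec)
  then have "2 * \<eta> * c * norm ((M, u, p) - sol) \<le> 2 * \<eta> * c * (2 * norm (iter 1 - sol))"
    using c0 \<eta>_pos by (intro mult_left_mono) auto
  ultimately have "norm ((X t - \<eta> *\<^sub>R LX M u p) - (Xs - \<eta> *\<^sub>R Hs)) \<le>
      norm (iter 1 - sol) + 2 * \<eta> * c * (2 * norm (iter 1 - sol))"
    using dist_gradient_step[OF feas c, of "X t"] by linarith
  also have "\<dots> \<le> 2 * (1 + 2 * \<eta> * c) * norm (iter 1 - sol)"
    by (simp add: algebra_simps)
  also note init
  finally show "eigval (r + 1) (X t - \<eta> *\<^sub>R LX M u p) \<le> 0"
    using r sym unfolding rt_def by (intro eigval_nonpos_near_sol) auto
qed (rule r(2))

section \<open>Transfer between exact and truncated runs\<close>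

lemma extragradient_transfer:
  assumes P: "\<And>t M u p Y. t \<ge> 1 \<Longrightarrow> (M, u, p) \<in> {iter t, half (Suc t)} \<Longrightarrow>
      P (X t - \<eta> *\<^sub>R LX M u p) Y \<longleftrightarrow> psd_proj (X t - \<eta> *\<^sub>R LX M u p) Y"
  shows "extragradient P LX Ly Ll K \<eta> X y l Z w \<mu>"
  using run P by (auto simp: extragradient_def iter_def half_def)

text \<open>\<open>P\<close> is a relation that may be many-valued elsewhere. By induction the other
  run presents it only with the arguments of the exact run, where it agrees with the single-valued
  \<open>psd_proj\<close>.\<close>

lemma extragradient_transfer_unique:
  assumes P: "\<And>t M u p Y. t \<ge> 1 \<Longrightarrow> (M, u, p) \<in> {iter t, half (Suc t)} \<Longrightarrow>
      P (X t - \<eta> *\<^sub>R LX M u p) Y \<longleftrightarrow> psd_proj (X t - \<eta> *\<^sub>R LX M u p) Y"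
    and run': "extragradient P LX Ly Ll K \<eta> X' y' l' Z' w' \<mu>'"
    and start': "(X' 1, y' 1, l' 1) = (X 1, y 1, l 1)"
  shows "t \<ge> 1 \<Longrightarrow> (X' t, y' t, l' t) = (X t, y t, l t)"
    and "t \<ge> 2 \<Longrightarrow> (Z' t, w' t, \<mu>' t) = (Z t, w t, \<mu> t)"
proof -
  have step: "(Z' (Suc t), w' (Suc t), \<mu>' (Suc t)) = (Z (Suc t), w (Suc t), \<mu> (Suc t)) \<and>
      (X' (Suc t), y' (Suc t), l' (Suc t)) = (X (Suc t), y (Suc t), l (Suc t))"
    if t: "t \<ge> 1" and eq: "(X' t, y' t, l' t) = (X t, y t, l t)" for t
  proof -
    have run_t: "P (X t - \<eta> *\<^sub>R LX (X t) (y t) (l t)) (Z' (Suc t))"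
      "w' (Suc t) = y t + \<eta> *\<^sub>R Ly (X t) (y t) (l t)"
      "\<mu>' (Suc t) = closest_point K (l t + \<eta> *\<^sub>R Ll (X t) (y t) (l t))"
      "P (X t - \<eta> *\<^sub>R LX (Z' (Suc t)) (w' (Suc t)) (\<mu>' (Suc t))) (X' (Suc t))"
      "y' (Suc t) = y t + \<eta> *\<^sub>R Ly (Z' (Suc t)) (w' (Suc t)) (\<mu>' (Suc t))"
      "l' (Suc t) = closest_point K (l t + \<eta> *\<^sub>R Ll (Z' (Suc t)) (w' (Suc t)) (\<mu>' (Suc t)))"
      using run' t eq by (auto simp: extragradient_def)
    note step = run_step[OF t]
    have "psd_proj (X t - \<eta> *\<^sub>R LX (X t) (y t) (l t)) (Z' (Suc t))"
      using run_t(1) P[OF t, of "X t" "y t" "l t"] by (simp add: iter_def)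
    \<comment> \<open>The half step must be identified first, because it determines the argument of
      the second projection.\<close>
    then have half: "Z' (Suc t) = Z (Suc t)" "w' (Suc t) = w (Suc t)" "\<mu>' (Suc t) = \<mu> (Suc t)"
      using step(1-3) run_t(2,3) by (simp_all add: psd_proj_def)
    have "psd_proj (X t - \<eta> *\<^sub>R LX (Z (Suc t)) (w (Suc t)) (\<mu> (Suc t))) (X' (Suc t))"
      using run_t(4) P[OF t, of "Z (Suc t)" "w (Suc t)" "\<mu> (Suc t)"] by (simp add: half half_def)
    then show ?thesis
      using step(4-6) run_t(5,6) half by (simp add: psd_proj_def)
  qed
  have main: "(X' t, y' t, l' t) = (X t, y t, l t)" if "t \<ge> 1" for t
    using that
  proof (induction t rule: nat_induct_at_least)
    case base
    show ?case by (rule start')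
  next
    case (Suc t)
    then show ?case using step[of t] by blast
  qed
  then show "t \<ge> 1 \<Longrightarrow> (X' t, y' t, l' t) = (X t, y t, l t)" .
  show "(Z' t, w' t, \<mu>' t) = (Z t, w t, \<mu> t)" if t: "t \<ge> 2"
  proof -
    obtain s where "t = Suc s" "s \<ge> 1"
      using t by (cases t) auto
    then show ?thesis
      using step[of s] main[of s] by blast
  qed
qed

text \<open>Both suprema run over compact sets, so they are bounded and dominate the terms of each
  test point.\<close>

lemma dist_iter_1_le:
  assumes u: "norm u \<le> 2 * norm ys" and p: "p \<in> K"
  shows "(norm (iter 1 - (Xs, u, p)))\<^sup>2 \<le> (norm (X 1 - Xs))\<^sup>2 +
    (SUP y'\<in>{y'. norm y' \<le> 2 * norm ys}. (norm (y 1 - y'))\<^sup>2) + (SUP l'\<in>K. (norm (l 1 - l'))\<^sup>2)"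
proof -
  have bdd: "bdd_above ((\<lambda>q. (norm (q0 - q))\<^sup>2) ` S)" if "compact S"
    for S :: "'z::real_normed_vector set" and q0
    by (intro bounded_imp_bdd_above compact_imp_bounded compact_continuous_image that continuous_intros)
  have ball: "{y'. norm y' \<le> 2 * norm ys} = cball 0 (2 * norm ys)"
    by auto
  have "(norm (y 1 - u))\<^sup>2 \<le> (SUP y'\<in>{y'. norm y' \<le> 2 * norm ys}. (norm (y 1 - y'))\<^sup>2)"
    unfolding ball using u by (intro cSUP_upper bdd compact_cball) simp
  moreover have "(norm (l 1 - p))\<^sup>2 \<le> (SUP l'\<in>K. (norm (l 1 - l'))\<^sup>2)"
    by (intro cSUP_upper p bdd K)
  ultimately show ?thesis
    by (simp add: iter_def norm_triple)
qed

end

text \<open>For \<open>S = 0\<close> the bound is infinite and gives no information, but the claim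
  is then trivial.\<close>

lemma step_bound_imp:
  assumes \<eta>: "0 < \<eta>" and S: "0 \<le> S" and le: "ereal \<eta> \<le> 1 / ereal (2 * sqrt S)"
  shows "4 * \<eta>\<^sup>2 * S \<le> 1"
proof (cases "S = 0")
  case False
  with S have pos: "0 < sqrt S"
    by simp
  have "1 / ereal (2 * sqrt S) = ereal (1 / (2 * sqrt S))"
    using pos by (simp add: one_ereal_def)
  with le have "\<eta> \<le> 1 / (2 * sqrt S)"
    by simp
  then have "2 * \<eta> * sqrt S \<le> 1"
    using pos by (simp add: field_simps)
  then have "(2 * \<eta> * sqrt S)\<^sup>2 \<le> 1"
    using \<eta> pos by (intro power_le_one) auto
  then show ?thesis
    using S by (simp add: power_mult_distrib)
qed simp

text \<open>Truncation being a relation, replaceability has two halves: the exact run is a truncated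
  run, and no other truncated run has the same start. The bounds on \<open>r\<close> keep the
  eigenvalue indices in range, also under truncated subtraction.\<close>

theorem theorem4p1:
  fixes f g :: "real^'n^'n \<Rightarrow> real" and gradf :: "real^'n^'n \<Rightarrow> real^'n^'n"
    and G :: "real^'n^'n \<Rightarrow> 'e::euclidean_space \<Rightarrow> real"
    and GX :: "real^'n^'n \<Rightarrow> 'e \<Rightarrow> real^'n^'n" and Gl :: "real^'n^'n \<Rightarrow> 'e \<Rightarrow> 'e"
    and K :: "'e set"
    and A :: "'m::finite \<Rightarrow> real^'n^'n" and b :: "real^'m"
    and \<beta> \<rho>X \<rho>l \<rho>Xl \<rho>lX \<eta> :: real and r :: nat
    and Xs :: "real^'n^'n" and ys :: "real^'m" and ls :: 'e
    and X Z :: "nat \<Rightarrow> real^'n^'n" and y w :: "nat \<Rightarrow> real^'m" and l \<mu> :: "nat \<Rightarrow> 'e"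
  defines "LX \<equiv> grad_X gradf GX A" and "Ly \<equiv> grad_y A b" and "Ll \<equiv> grad_l Gl"
    and "nA \<equiv> map_norm A"
    and "gradLs \<equiv> grad_X gradf GX A Xs ys ls"
  defines "rt \<equiv> CARD('n) - rank gradLs"
  defines "dist1 \<equiv> norm ((X 1, y 1, l 1) - (Xs, ys, ls))"
  defines "R0 \<equiv> \<eta> * max (eigval (CARD('n) - r) gradLs)
                         (sqrt (real rt) * eigval (CARD('n) - r + rt - 1) gradLs)
                / (2 * (1 + 2 * \<eta> * Max {\<beta> + \<rho>X, nA, \<rho>Xl}))"
  defines "Rsq \<equiv> (norm (X 1 - Xs))\<^sup>2
                + (SUP y'\<in>{y'. norm y' \<le> 2 * norm ys}. (norm (y 1 - y'))\<^sup>2)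
                + (SUP l'\<in>K. (norm (l 1 - l'))\<^sup>2)"
    and "R1 \<equiv> 3 * sqrt 2 * Max {2 * R0, 3 * sqrt 2 * norm ys, sqrt 2 * diameter K} * dist1"
  assumes f_convex: "convex_on sym_mats f"
    and f_grad: "is_gradient_sym f gradf"
    and f_smooth: "\<beta>-lipschitz_on sym_mats gradf"
    and A_sym: "\<And>i. A i \<in> sym_mats"
    and K: "compact K" "convex K"
    and g_convex: "convex_on sym_mats g"
    and g_max: "\<And>M. M \<in> sym_mats \<Longrightarrow> (\<exists>p\<in>K. g M = G M p) \<and> (\<forall>p\<in>K. G M p \<le> g M)"
    and G_convex: "\<And>p. p \<in> K \<Longrightarrow> convex_on sym_mats (\<lambda>M. G M p)"
    and G_concave: "\<And>M. M \<in> psd_cone \<Longrightarrow> concave_on K (G M)"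
    and G_grad: "are_partial_gradients K G GX Gl"
    and \<rho>X: "\<And>p. p \<in> K \<Longrightarrow> \<rho>X-lipschitz_on psd_cone (\<lambda>M. GX M p)"
    and \<rho>l: "\<And>M. M \<in> psd_cone \<Longrightarrow> \<rho>l-lipschitz_on K (Gl M)"
    and \<rho>Xl: "\<And>M. M \<in> psd_cone \<Longrightarrow> \<rho>Xl-lipschitz_on K (GX M)"
    and \<rho>lX: "\<And>p. p \<in> K \<Longrightarrow> \<rho>lX-lipschitz_on psd_cone (\<lambda>M. Gl M p)"
    and slater: "\<exists>XS\<in>pd_cone. lin_map A XS = b"
    and bounded: "bdd_below ((\<lambda>M. f M + g M) ` feasible A b)"
    and Xs_opt: "Xs \<in> feasible A b" "\<And>M. M \<in> feasible A b \<Longrightarrow> f Xs + g Xs \<le> f M + g M"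
    and dual: "saddle_point (lagrangian f G A b) K Xs ys ls"
    and eta: "0 < \<eta>" "ereal \<eta> \<le> step_bound \<beta> \<rho>X \<rho>l \<rho>Xl \<rho>lX nA"
    and start: "X 1 \<in> psd_cone" "l 1 \<in> K"
    and run: "extragradient psd_proj LX Ly Ll K \<eta> X y l Z w \<mu>"
    and r: "rt \<le> r" "r < CARD('n)" "r + 2 \<le> CARD('n) + rt"
    and init: "dist1 \<le> R0"
  shows
    "extragradient (trunc_psd_proj r) LX Ly Ll K \<eta> X y l Z w \<mu>
     \<and> (\<forall>X' y' l' Z' w' \<mu>'.
          extragradient (trunc_psd_proj r) LX Ly Ll K \<eta> X' y' l' Z' w' \<mu>' \<and>
          (X' 1, y' 1, l' 1) = (X 1, y 1, l 1) \<longrightarrow>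
          (\<forall>t\<ge>1. (X' t, y' t, l' t) = (X t, y t, l t)) \<and>
          (\<forall>t\<ge>2. (Z' t, w' t, \<mu>' t) = (Z t, w t, \<mu> t)))
     \<and> (\<forall>T\<ge>1. let Xbar = (1 / real T) *\<^sub>R (\<Sum>t=1..T. Z (t + 1)) in
          f Xbar + g Xbar - f Xs - g Xs \<le> Rsq / (2 * \<eta> * real T) \<and>
          (ys \<noteq> 0 \<longrightarrow> norm (lin_map A Xbar - b) \<le> Rsq / (2 * norm ys * \<eta> * real T)))
     \<and> (\<forall>T\<ge>1.
          f (Z (T + 1)) + g (Z (T + 1)) - f Xs - g Xs \<le> R1 / (\<eta> * sqrt (real T)) \<and>
          (ys \<noteq> 0 \<longrightarrow>
            norm (lin_map A (Z (T + 1)) - b) \<le> R1 / (norm ys * \<eta> * sqrt (real T))))"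
proof -
  have "ereal \<eta> \<le> 1 / ereal (2 * sqrt ((\<beta> + \<rho>X)\<^sup>2 + nA\<^sup>2 + \<rho>lX\<^sup>2))"
    and "ereal \<eta> \<le> 1 / ereal (2 * sqrt (\<rho>l\<^sup>2 + 2 * max (nA\<^sup>2) (\<rho>Xl\<^sup>2)))"
    using eta(2) by (auto simp: step_bound_def)
  then have step: "4 * \<eta>\<^sup>2 * ((\<beta> + \<rho>X)\<^sup>2 + nA\<^sup>2 + \<rho>lX\<^sup>2) \<le> 1"
      "4 * \<eta>\<^sup>2 * (\<rho>l\<^sup>2 + 2 * max (nA\<^sup>2) (\<rho>Xl\<^sup>2)) \<le> 1"
    using eta(1) by (intro step_bound_imp; auto simp: le_max_iff_disj intro!: add_nonneg_nonneg)+
  interpret extragradient_saddle f gradf G GX Gl K A b \<beta> \<rho>X \<rho>l \<rho>Xl \<rho>lX \<eta> g Xs ys ls X Z y w l \<mu>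
    using f_convex f_grad f_smooth A_sym K G_convex G_concave G_grad \<rho>X \<rho>l \<rho>Xl \<rho>lX eta(1) step
      g_max Xs_opt(1) dual start run
    unfolding nA_def LX_def Ly_def Ll_def by unfold_locales
  define c where "c = Max {\<beta> + \<rho>X, nA, \<rho>Xl}"
  have c: "\<beta> + \<rho>X \<le> c" "map_norm A \<le> c" "\<rho>Xl \<le> c"
    by (auto simp: c_def nA_def)
  have "0 \<le> c"
    using c(2) map_norm_nonneg[of A] by linarith
  then have c_pos: "0 < 2 * (1 + 2 * \<eta> * c)"
    using eta(1) by (simp add: add_pos_nonneg)
  have dist1: "dist1 = norm (iter 1 - sol)"
    by (simp add: dist1_def iter_def sol_def)
  have init': "2 * (1 + 2 * \<eta> * c) * norm (iter 1 - sol) \<le>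
      \<eta> * max (eigval (CARD('n) - r) gradLs) (sqrt (real rt) * eigval (CARD('n) - r + rt - 1) gradLs)"
    using init c_pos unfolding R0_def c_def[symmetric] dist1
    by (simp add: pos_le_divide_eq mult.commute[of "norm _"])
  note trunc = trunc_psd_proj_iff_iter[OF r[unfolded rt_def gradLs_def] c
      init'[unfolded rt_def gradLs_def]]
  have trunc_run: "extragradient (trunc_psd_proj r) LX Ly Ll K \<eta> X y l Z w \<mu>"
    using extragradient_transfer[OF trunc] unfolding LX_def Ly_def Ll_def .
  have unique: "(\<forall>t\<ge>1. (X' t, y' t, l' t) = (X t, y t, l t)) \<and> (\<forall>t\<ge>2. (Z' t, w' t, \<mu>' t) = (Z t, w t, \<mu> t))"
    if "extragradient (trunc_psd_proj r) LX Ly Ll K \<eta> X' y' l' Z' w' \<mu>'"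
      "(X' 1, y' 1, l' 1) = (X 1, y 1, l 1)" for X' y' l' Z' w' \<mu>'
    using extragradient_transfer_unique[OF trunc that[unfolded LX_def Ly_def Ll_def]] by blast
  have ergodic: "let Xbar = (1 / real T) *\<^sub>R (\<Sum>t=1..T. Z (t + 1)) in
      f Xbar + g Xbar - f Xs - g Xs \<le> Rsq / (2 * \<eta> * real T) \<and>
      (ys \<noteq> 0 \<longrightarrow> norm (lin_map A Xbar - b) \<le> Rsq / (2 * norm ys * \<eta> * real T))"
    if T: "T \<ge> 1" for T
  proof -
    define Xbar where "Xbar = (1 / real T) *\<^sub>R (\<Sum>t=1..T. Z (t + 1))"
    have psd: "Xbar \<in> psd_cone"
      unfolding Xbar_def using half_feas
      by (intro psd_cone_scale psd_cone_sum) (auto simp: half_def feas_def)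
    have gap: "L Xbar u p - L Xs ys ls \<le> Rsq / (2 * \<eta> * real T)" if "norm u \<le> 2 * norm ys" "p \<in> K" for u p
    proof -
      have "L Xbar u p - L Xs ys ls \<le> (norm (iter 1 - (Xs, u, p)))\<^sup>2 / (2 * \<eta> * real T)"
        unfolding Xbar_def by (rule ergodic_gap[OF T that(2)])
      also have "\<dots> \<le> Rsq / (2 * \<eta> * real T)"
        unfolding Rsq_def using dist_iter_1_le[OF that] eta(1) by (intro divide_right_mono) auto
      finally show ?thesis .
    qed
    show ?thesis
      unfolding Let_def Xbar_def[symmetric] using gap_imp_accuracy[OF psd gap] by (simp add: ac_simps)
  qed
  have last: "f (Z (T + 1)) + g (Z (T + 1)) - f Xs - g Xs \<le> R1 / (\<eta> * sqrt (real T)) \<and>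
      (ys \<noteq> 0 \<longrightarrow> norm (lin_map A (Z (T + 1)) - b) \<le> R1 / (norm ys * \<eta> * sqrt (real T)))"
    if T: "T \<ge> 1" for T
  proof -
    have psd: "Z (Suc T) \<in> psd_cone"
      using half_feas[OF T] by (auto simp: half_def feas_def)
    define R where "R = Max {2 * R0, 3 * sqrt 2 * norm ys, sqrt 2 * diameter K}"
    have R: "2 * R0 \<le> R" "3 * sqrt 2 * norm ys \<le> R" "sqrt 2 * diameter K \<le> R"
      by (auto simp: R_def)
    \<comment> \<open>The assumption \<open>dist1 \<le> R0\<close> turns the entry
      \<open>2 * R0\<close> of the maximum into the bound on twice the initial distance that
      \<open>last_iterate_gap\<close> asks for.\<close>
    have gap: "L (Z (Suc T)) u p - L Xs ys ls \<le> R1 / (\<eta> * sqrt (real T))"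
      if "norm u \<le> 2 * norm ys" "p \<in> K" for u p
      unfolding R1_def R_def[symmetric] dist1 using init R
      by (intro last_iterate_gap[OF T that(2,1)]) (auto simp: dist1)
    show ?thesis
      using gap_imp_accuracy[OF psd gap] by (simp add: ac_simps)
  qed
  show ?thesis
    using trunc_run unique ergodic last by blast
qed

end
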